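(* Suppose $A\,|\,B$ is an irreducible extension of $K$-algebras and ${}_AP_A$ is a bimodule. Let $T=(A\otimes_BA)^B$. Define two pairings of $\mathrm{Hom}({}_BA_B,{}_BP_B)$ and $T$ with values in $P^B$ by $$\langle\alpha,t\rangle=\alpha(t^1)t^2,\qquad[u,\beta]=u^1\beta(u^2)$$ for $\alpha,\beta\in\mathrm{Hom}({}_BA_B,{}_BP_B)$ and $t,u\in T$. Then the two pairings are nondegenerate with respect to $\alpha,\beta\in\mathrm{Hom}({}_BA_B,{}_BP_B)$ (that is, $\langle\alpha,t\rangle=0$ for all $t\in T$ implies $\alpha=0$, and $[u,\beta]=0$ for all $u\in T$ implies $\beta=0$). Moreover, the mapping $\sigma:\alpha\mapsto\alpha^\sigma$ of $\mathrm{Hom}({}_BA_B,{}_BP_B)$ to itself defined by $\langle\alpha,t\rangle=[t,\alpha^\sigma]$ for all $t\in T$ is a (well-defined) bijection satisfying $\sigma^{\pm1}(\lambda_p)=\rho_p$ for each $p\in P^B$, and $\alpha^\sigma(1_A)=\alpha(1_A)$ for all $\alpha\in\mathrm{Hom}({}_BA_B,{}_BP_B)$.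
   Context: $K$ is a commutative ring, $A$ an associative unital $K$-algebra, $B\subseteq A$ a unital subalgebra. For an $A$-$A$-bimodule $M$, $M^B=\{m\in M: bm=mb\ \forall b\in B\}$. $R=A^B$ is the centralizer of $B$ in $A$. Elements of $T=(A\otimes_BA)^B$ are written $t=t^1\otimes_Bt^2$ with summation suppressed. For $p\in P^B$, $\lambda_p,\rho_p\in\mathrm{Hom}({}_BA_B,{}_BP_B)$ are $\lambda_p(a)=pa$ and $\rho_p(a)=ap$. $A\,|\,B$ is \emph{depth two} if for some positive integer $N$, $A\otimes_BA$ is isomorphic to a direct summand of $A^N$, both as natural $B$-$A$-bimodules and as natural $A$-$B$-bimodules. $A\,|\,B$ is \emph{irreducible} if it is depth two and $R\subseteq B$. *)

theory Defs
  imports "HOL-Algebra.Free_Abelian_Groups" "HOL-Algebra.Subrings" "HOL-Algebra.Module"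
begin

section \<open>Algebras and bimodules\<close>

text \<open>The library locale \<open>algebra\<close> requires commutative multiplication, hence this variant.\<close>

locale assoc_algebra = module K A + ring A
  for K :: "('k, 'x) ring_scheme" (structure) and A :: "('k, 'a, 'y) module_scheme" (structure) +
  assumes smult_mult_left:
      "\<lbrakk>k \<in> carrier K; x \<in> carrier A; y \<in> carrier A\<rbrakk>
        \<Longrightarrow> (k \<odot>\<^bsub>A\<^esub> x) \<otimes>\<^bsub>A\<^esub> y = k \<odot>\<^bsub>A\<^esub> (x \<otimes>\<^bsub>A\<^esub> y)"
    and smult_mult_right:
      "\<lbrakk>k \<in> carrier K; x \<in> carrier A; y \<in> carrier A\<rbrakk>
        \<Longrightarrow> x \<otimes>\<^bsub>A\<^esub> (k \<odot>\<^bsub>A\<^esub> y) = k \<odot>\<^bsub>A\<^esub> (x \<otimes>\<^bsub>A\<^esub> y)"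

definition unital_subalgebra ::
    "'a set \<Rightarrow> ('k, 'x) ring_scheme \<Rightarrow> ('k, 'a, 'y) module_scheme \<Rightarrow> bool"
  where "unital_subalgebra B K A \<longleftrightarrow> subring B A \<and> submodule B K A"

text \<open>As with the library record \<open>module\<close>, the fields \<open>mult\<close> and \<open>one\<close> inherited from \<open>ring\<close>
  carry no meaning for a bimodule; only the additive group and the two actions matter.\<close>

record ('l, 'r, 'm) bimodule = "'m ring" +
  lact :: "'l \<Rightarrow> 'm \<Rightarrow> 'm"
  ract :: "'m \<Rightarrow> 'r \<Rightarrow> 'm"

text \<open>For algebras over \<open>K\<close> the two actions of \<open>K\<close> induced on a bimodule are not required to
  agree, so bimodules that are symmetric over \<open>K\<close> are a special case.\<close>

locale bimodule = L?: ring L + R?: ring R + M?: abelian_group M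
  for L :: "('l, 'x) ring_scheme" and R :: "('r, 'y) ring_scheme"
    and M :: "('l, 'r, 'm, 'z) bimodule_scheme" +
  assumes lact_closed:
      "\<lbrakk>a \<in> carrier L; m \<in> carrier M\<rbrakk> \<Longrightarrow> lact M a m \<in> carrier M"
    and lact_add_left:
      "\<lbrakk>a \<in> carrier L; b \<in> carrier L; m \<in> carrier M\<rbrakk>
        \<Longrightarrow> lact M (a \<oplus>\<^bsub>L\<^esub> b) m = lact M a m \<oplus>\<^bsub>M\<^esub> lact M b m"
    and lact_add_right:
      "\<lbrakk>a \<in> carrier L; m \<in> carrier M; n \<in> carrier M\<rbrakk>
        \<Longrightarrow> lact M a (m \<oplus>\<^bsub>M\<^esub> n) = lact M a m \<oplus>\<^bsub>M\<^esub> lact M a n"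
    and lact_mult:
      "\<lbrakk>a \<in> carrier L; b \<in> carrier L; m \<in> carrier M\<rbrakk>
        \<Longrightarrow> lact M (a \<otimes>\<^bsub>L\<^esub> b) m = lact M a (lact M b m)"
    and lact_one:
      "m \<in> carrier M \<Longrightarrow> lact M \<one>\<^bsub>L\<^esub> m = m"
    and ract_closed:
      "\<lbrakk>m \<in> carrier M; r \<in> carrier R\<rbrakk> \<Longrightarrow> ract M m r \<in> carrier M"
    and ract_add_right:
      "\<lbrakk>m \<in> carrier M; r \<in> carrier R; s \<in> carrier R\<rbrakk>
        \<Longrightarrow> ract M m (r \<oplus>\<^bsub>R\<^esub> s) = ract M m r \<oplus>\<^bsub>M\<^esub> ract M m s"
    and ract_add_left:
      "\<lbrakk>m \<in> carrier M; n \<in> carrier M; r \<in> carrier R\<rbrakk>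
        \<Longrightarrow> ract M (m \<oplus>\<^bsub>M\<^esub> n) r = ract M m r \<oplus>\<^bsub>M\<^esub> ract M n r"
    and ract_mult:
      "\<lbrakk>m \<in> carrier M; r \<in> carrier R; s \<in> carrier R\<rbrakk>
        \<Longrightarrow> ract M m (r \<otimes>\<^bsub>R\<^esub> s) = ract M (ract M m r) s"
    and ract_one:
      "m \<in> carrier M \<Longrightarrow> ract M m \<one>\<^bsub>R\<^esub> = m"
    and lact_ract:
      "\<lbrakk>a \<in> carrier L; m \<in> carrier M; s \<in> carrier R\<rbrakk>
        \<Longrightarrow> ract M (lact M a m) s = lact M a (ract M m s)"

text \<open>Homomorphisms are extensional (equal to \<open>undefined\<close> off the carrier), so that equality of
  elements of this set is equality of homomorphisms.\<close>

definition bimod_hom ::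
    "('l, 'x) ring_scheme \<Rightarrow> ('r, 'y) ring_scheme \<Rightarrow> ('l, 'r, 'm, 'z) bimodule_scheme \<Rightarrow>
     ('l, 'r, 'n, 'w) bimodule_scheme \<Rightarrow> ('m \<Rightarrow> 'n) set"
  where "bimod_hom L R M N =
    {f \<in> carrier M \<rightarrow>\<^sub>E carrier N.
       (\<forall>m \<in> carrier M. \<forall>n \<in> carrier M. f (m \<oplus>\<^bsub>M\<^esub> n) = f m \<oplus>\<^bsub>N\<^esub> f n) \<and>
       (\<forall>a \<in> carrier L. \<forall>m \<in> carrier M. f (lact M a m) = lact N a (f m)) \<and>
       (\<forall>m \<in> carrier M. \<forall>a \<in> carrier R. f (ract M m a) = ract N (f m) a)}"

definition subbimodule ::
    "'m set \<Rightarrow> ('l, 'x) ring_scheme \<Rightarrow> ('r, 'y) ring_scheme \<Rightarrow>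
     ('l, 'r, 'm, 'z) bimodule_scheme \<Rightarrow> bool"
  where "subbimodule S L R M \<longleftrightarrow>
    subgroup S (add_monoid M) \<and>
    (\<forall>a \<in> carrier L. \<forall>m \<in> S. lact M a m \<in> S) \<and>
    (\<forall>m \<in> S. \<forall>a \<in> carrier R. ract M m a \<in> S)"

definition direct_summand ::
    "'m set \<Rightarrow> ('l, 'x) ring_scheme \<Rightarrow> ('r, 'y) ring_scheme \<Rightarrow>
     ('l, 'r, 'm, 'z) bimodule_scheme \<Rightarrow> bool"
  where "direct_summand S L R M \<longleftrightarrow> subbimodule S L R M \<and>
    (\<exists>S'. subbimodule S' L R M \<and> S <+>\<^bsub>M\<^esub> S' = carrier M \<and> S \<inter> S' = {\<zero>\<^bsub>M\<^esub>})"

definition iso_to_direct_summand ::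
    "('l, 'x) ring_scheme \<Rightarrow> ('r, 'y) ring_scheme \<Rightarrow> ('l, 'r, 'm, 'z) bimodule_scheme \<Rightarrow>
     ('l, 'r, 'n, 'w) bimodule_scheme \<Rightarrow> bool"
  where "iso_to_direct_summand L R M N \<longleftrightarrow>
    (\<exists>S f. direct_summand S L R N \<and>
       f \<in> bimod_hom L R M (N\<lparr>carrier := S\<rparr>) \<and> bij_betw f (carrier M) S)"

definition regular_bimodule :: "('a, 'x) ring_scheme \<Rightarrow> ('a, 'a, 'a) bimodule"
  where "regular_bimodule A =
    \<lparr>carrier = carrier A, monoid.mult = monoid.mult A, one = \<one>\<^bsub>A\<^esub>, ring.zero = \<zero>\<^bsub>A\<^esub>, add = ring.add A,
     lact = monoid.mult A, ract = monoid.mult A\<rparr>"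

definition power_bimodule ::
    "('l, 'r, 'm, 'z) bimodule_scheme \<Rightarrow> nat \<Rightarrow> ('l, 'r, nat \<Rightarrow> 'm) bimodule"
  where "power_bimodule M N =
    \<lparr>carrier = {..<N} \<rightarrow>\<^sub>E carrier M, monoid.mult = undefined, one = undefined,
     ring.zero = (\<lambda>i\<in>{..<N}. \<zero>\<^bsub>M\<^esub>), add = (\<lambda>f g. \<lambda>i\<in>{..<N}. f i \<oplus>\<^bsub>M\<^esub> g i),
     lact = (\<lambda>a f. \<lambda>i\<in>{..<N}. lact M a (f i)), ract = (\<lambda>f a. \<lambda>i\<in>{..<N}. ract M (f i) a)\<rparr>"

definition centralized ::
    "'a set \<Rightarrow> ('a, 'a, 'm, 'z) bimodule_scheme \<Rightarrow> 'm set"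
  where "centralized B M = {m \<in> carrier M. \<forall>b \<in> B. lact M b m = ract M m b}"


section \<open>Tensor products over a noncommutative ring\<close>

abbreviation tensor_gens ::
    "('l, 'b, 'm, 'z) bimodule_scheme \<Rightarrow> ('b, 'r, 'n, 'w) bimodule_scheme \<Rightarrow>
     ('m \<times> 'n \<Rightarrow>\<^sub>0 int) monoid"
  where "tensor_gens M N \<equiv> free_Abelian_group (carrier M \<times> carrier N)"

definition tensor_relators ::
    "('b, 'x) ring_scheme \<Rightarrow> ('l, 'b, 'm, 'z) bimodule_scheme \<Rightarrow>
     ('b, 'r, 'n, 'w) bimodule_scheme \<Rightarrow> ('m \<times> 'n \<Rightarrow>\<^sub>0 int) set"
  where "tensor_relators S M N =
    {frag_of (m \<oplus>\<^bsub>M\<^esub> m', n) - frag_of (m, n) - frag_of (m', n) | m m' n.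
        m \<in> carrier M \<and> m' \<in> carrier M \<and> n \<in> carrier N} \<union>
     {frag_of (m, n \<oplus>\<^bsub>N\<^esub> n') - frag_of (m, n) - frag_of (m, n') | m n n'.
        m \<in> carrier M \<and> n \<in> carrier N \<and> n' \<in> carrier N} \<union>
     {frag_of (ract M m s, n) - frag_of (m, lact N s n) | m s n.
        m \<in> carrier M \<and> s \<in> carrier S \<and> n \<in> carrier N}"

definition tensor_rels ::
    "('b, 'x) ring_scheme \<Rightarrow> ('l, 'b, 'm, 'z) bimodule_scheme \<Rightarrow>
     ('b, 'r, 'n, 'w) bimodule_scheme \<Rightarrow> ('m \<times> 'n \<Rightarrow>\<^sub>0 int) set"
  where "tensor_rels S M N = generate (tensor_gens M N) (tensor_relators S M N)"

definition tensor_class ::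
    "('b, 'x) ring_scheme \<Rightarrow> ('l, 'b, 'm, 'z) bimodule_scheme \<Rightarrow>
     ('b, 'r, 'n, 'w) bimodule_scheme \<Rightarrow> ('m \<times> 'n \<Rightarrow>\<^sub>0 int) \<Rightarrow> ('m \<times> 'n \<Rightarrow>\<^sub>0 int) set"
  where "tensor_class S M N c = tensor_rels S M N #>\<^bsub>tensor_gens M N\<^esub> c"

text \<open>The actions are computed on representatives; the unions run over all representatives of a
  class and are unions of one and the same coset (lemmas \<open>lact_tensor_class\<close> and
  \<open>ract_tensor_class\<close> below).\<close>

definition tensor ::
    "('b, 'x) ring_scheme \<Rightarrow> ('l, 'b, 'm, 'z) bimodule_scheme \<Rightarrow>
     ('b, 'r, 'n, 'w) bimodule_scheme \<Rightarrow> ('l, 'r, ('m \<times> 'n \<Rightarrow>\<^sub>0 int) set) bimodule"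
  where "tensor S M N =
    (let Q = tensor_gens M N Mod tensor_rels S M N in
     \<lparr>carrier = carrier Q, monoid.mult = undefined, one = undefined, ring.zero = \<one>\<^bsub>Q\<^esub>, add = monoid.mult Q,
      lact = (\<lambda>a t. \<Union>c\<in>t. tensor_class S M N (frag_extend (\<lambda>(m, n). frag_of (lact M a m, n)) c)),
      ract = (\<lambda>t a. \<Union>c\<in>t. tensor_class S M N (frag_extend (\<lambda>(m, n). frag_of (m, ract N n a)) c))\<rparr>)"

text \<open>\<open>frag_eval P \<phi>\<close> sends a formal sum of pairs \<open>(m, n)\<close> to the corresponding sum of the
  \<open>\<phi> m n\<close> in \<open>P\<close>. For biadditive balanced \<open>\<phi>\<close> it is constant on tensor classes, and
  \<open>tensor_lift P \<phi>\<close> is the induced map on the tensor product (lemma \<open>tensor_lift_class\<close> below).\<close>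

definition frag_eval :: "('p, 'z) ring_scheme \<Rightarrow> ('m \<Rightarrow> 'n \<Rightarrow> 'p) \<Rightarrow> ('m \<times> 'n \<Rightarrow>\<^sub>0 int) \<Rightarrow> 'p"
  where "frag_eval P \<phi> c =
    (\<Oplus>\<^bsub>P\<^esub>k \<in> Poly_Mapping.keys c. [Poly_Mapping.lookup c k] \<cdot>\<^bsub>P\<^esub> \<phi> (fst k) (snd k))"

definition tensor_lift ::
    "('p, 'z) ring_scheme \<Rightarrow> ('m \<Rightarrow> 'n \<Rightarrow> 'p) \<Rightarrow> ('m \<times> 'n \<Rightarrow>\<^sub>0 int) set \<Rightarrow> 'p"
  where "tensor_lift P \<phi> t = the_elem (frag_eval P \<phi> ` t)"

lemma tensor_relatorsI:
  "m \<in> carrier M \<Longrightarrow> m' \<in> carrier M \<Longrightarrow> n \<in> carrier N \<Longrightarrow>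
    frag_of (m \<oplus>\<^bsub>M\<^esub> m', n) - frag_of (m, n) - frag_of (m', n) \<in> tensor_relators S M N"
  "m \<in> carrier M \<Longrightarrow> n \<in> carrier N \<Longrightarrow> n' \<in> carrier N \<Longrightarrow>
    frag_of (m, n \<oplus>\<^bsub>N\<^esub> n') - frag_of (m, n) - frag_of (m, n') \<in> tensor_relators S M N"
  "m \<in> carrier M \<Longrightarrow> s \<in> carrier S \<Longrightarrow> n \<in> carrier N \<Longrightarrow>
    frag_of (ract M m s, n) - frag_of (m, lact N s n) \<in> tensor_relators S M N"
  unfolding tensor_relators_def by blast+

lemma tensor_relators_cases:
  assumes "h \<in> tensor_relators S M N"
  obtains (l) m m' n where "m \<in> carrier M" "m' \<in> carrier M" "n \<in> carrier N"
        "h = frag_of (m \<oplus>\<^bsub>M\<^esub> m', n) - frag_of (m, n) - frag_of (m', n)"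
      | (r) m n n' where "m \<in> carrier M" "n \<in> carrier N" "n' \<in> carrier N"
        "h = frag_of (m, n \<oplus>\<^bsub>N\<^esub> n') - frag_of (m, n) - frag_of (m, n')"
      | (b) m s n where "m \<in> carrier M" "s \<in> carrier S" "n \<in> carrier N"
        "h = frag_of (ract M m s, n) - frag_of (m, lact N s n)"
  using assms unfolding tensor_relators_def
  by (elim UnE CollectE exE conjE) (assumption | rule that)+

lemma tensor_relators_closed:
  fixes M :: "('l, 's, 'm, 'z) bimodule_scheme" and N :: "('s, 'r, 'n, 'w) bimodule_scheme"
  assumes "bimodule L S M" and "bimodule S R N"
  shows "tensor_relators S M N \<subseteq> carrier (tensor_gens M N)"
proof -
  interpret M: bimodule L S M by fact
  interpret N: bimodule S R N by fact
  have diff: "x - y \<in> carrier (tensor_gens M N)"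
    if "x \<in> carrier (tensor_gens M N)" "y \<in> carrier (tensor_gens M N)"
    for x y :: "'m \<times> 'n \<Rightarrow>\<^sub>0 int"
    using that Poly_Mapping.keys_diff[of x y] by (auto simp: carrier_free_Abelian_group_iff)
  show ?thesis
  proof
    fix h assume "h \<in> tensor_relators S M N"
    then show "h \<in> carrier (tensor_gens M N)"
    proof (cases rule: tensor_relators_cases)
      case (l m m' n)
      then show ?thesis unfolding l(4) by (intro diff) auto
    next
      case (r m n n')
      then show ?thesis unfolding r(4) by (intro diff) auto
    next
      case (b m s n)
      then show ?thesis
        unfolding b(4) by (intro diff) (auto intro: M.ract_closed N.lact_closed)
    qed
  qed
qed

lemma tensor_class_map:
  assumes MN: "bimodule L S M" "bimodule S R N"
    and fg: "\<And>m n. m \<in> carrier M \<Longrightarrow> n \<in> carrier N \<Longrightarrow> f m \<in> carrier M \<and> g n \<in> carrier N"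
    and h: "h = frag_extend (\<lambda>(m, n). frag_of (f m, g n))"
    and rel: "\<And>r. r \<in> tensor_relators S M N \<Longrightarrow> h r \<in> tensor_relators S M N"
    and c: "c \<in> carrier (tensor_gens M N)"
  shows "(\<Union>d \<in> tensor_class S M N c. tensor_class S M N (h d)) = tensor_class S M N (h c)"
proof -
  let ?F = "tensor_gens M N"
  interpret F: group ?F by (rule group_free_Abelian_group)
  have cl: "h x \<in> carrier ?F" if "x \<in> carrier ?F" for x
  proof -
    have "Poly_Mapping.keys (h x) \<subseteq> (\<Union>k \<in> Poly_Mapping.keys x.
        Poly_Mapping.keys ((\<lambda>(m, n). frag_of (f m, g n)) k :: _ \<Rightarrow>\<^sub>0 int))"
      unfolding h by (rule keys_frag_extend)
    also have "\<dots> \<subseteq> carrier M \<times> carrier N"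
      using that fg by (fastforce simp: carrier_free_Abelian_group_iff keys_frag_of)
    finally show ?thesis by (simp add: carrier_free_Abelian_group_iff)
  qed
  note relF = tensor_relators_closed[OF MN]
  have sub: "subgroup (tensor_rels S M N) ?F"
    unfolding tensor_rels_def using relF by (rule F.generate_is_subgroup)
  have add: "h (x + y) = h x + h y" for x y
    by (simp add: h frag_extend_add)
  have rels: "h r \<in> tensor_rels S M N" if "r \<in> tensor_rels S M N" for r
    using that unfolding tensor_rels_def
  proof (induction rule: generate.induct)
    case one
    then show ?case using generate.one[of ?F] by (simp add: h)
  next
    case (incl x)
    then show ?case by (intro generate.incl rel)
  next
    case (inv x)
    then have "x \<in> carrier ?F" "h x \<in> carrier ?F" by (auto simp only: relF[THEN subsetD] rel)
    then have "h (inv\<^bsub>?F\<^esub> x) = inv\<^bsub>?F\<^esub> (h x)"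
      by (simp add: carrier_free_Abelian_group_iff h frag_extend_minus)
    then show ?case using generate.inv[OF rel[OF inv]] by metis
  next
    case (eng x y)
    then show ?case using generate.eng[OF eng(3,4)] by (simp add: add)
  qed
  have "tensor_class S M N (h d) = tensor_class S M N (h c)"
    if "d \<in> tensor_class S M N c" for d
  proof -
    from that obtain r where r: "r \<in> tensor_rels S M N" "d = r + c"
      by (auto simp: tensor_class_def r_coset_def)
    then have "h d \<in> tensor_rels S M N #>\<^bsub>?F\<^esub> h c"
      using rels[OF r(1)] by (auto simp: r_coset_def add)
    then show ?thesis
      unfolding tensor_class_def by (rule F.repr_independence[OF _ cl[OF c] sub, symmetric])
  qed
  moreover have "c \<in> tensor_class S M N c"
    unfolding tensor_class_def by (rule F.rcos_self[OF c sub])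
  ultimately show ?thesis by blast
qed

lemma lact_tensor_class:
  fixes M :: "('l, 's, 'm, 'z) bimodule_scheme" and N :: "('s, 'r, 'n, 'w) bimodule_scheme"
  assumes MN: "bimodule L S M" "bimodule S R N" and a: "a \<in> carrier L"
    and c: "c \<in> carrier (tensor_gens M N)"
  shows "lact (tensor S M N) a (tensor_class S M N c) =
    tensor_class S M N (frag_extend (\<lambda>(m, n). frag_of (lact M a m, n)) c)"
proof -
  interpret M: bimodule L S M by fact
  let ?h = "frag_extend (\<lambda>(m, n :: 'n). frag_of (lact M a m, n))"
  have "(\<Union>d \<in> tensor_class S M N c. tensor_class S M N (?h d)) = tensor_class S M N (?h c)"
  proof (rule tensor_class_map[OF MN, where f = "lact M a" and g = "\<lambda>n. n"])
    fix r assume "r \<in> tensor_relators S M N"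
    then show "?h r \<in> tensor_relators S M N"
    proof (cases rule: tensor_relators_cases)
      case (l m m' n)
      then show ?thesis
        using tensor_relatorsI(1)[of "lact M a m" M "lact M a m'" n N S] a
        by (simp add: frag_extend_diff M.lact_add_right M.lact_closed)
    next
      case (r m n n')
      then show ?thesis
        using tensor_relatorsI(2)[of "lact M a m" M n N n' S] a
        by (simp add: frag_extend_diff M.lact_closed)
    next
      case (b m s n)
      then show ?thesis
        using tensor_relatorsI(3)[of "lact M a m" M s S n N] a
        by (simp add: frag_extend_diff M.lact_closed M.lact_ract)
    qed
  qed (use a c M.lact_closed in auto)
  then show ?thesis
    by (simp add: tensor_def Let_def)
qed

lemma ract_tensor_class:
  fixes M :: "('l, 's, 'm, 'z) bimodule_scheme" and N :: "('s, 'r, 'n, 'w) bimodule_scheme"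
  assumes MN: "bimodule L S M" "bimodule S R N" and a: "a \<in> carrier R"
    and c: "c \<in> carrier (tensor_gens M N)"
  shows "ract (tensor S M N) (tensor_class S M N c) a =
    tensor_class S M N (frag_extend (\<lambda>(m, n). frag_of (m, ract N n a)) c)"
proof -
  interpret N: bimodule S R N by fact
  let ?h = "frag_extend (\<lambda>(m :: 'm, n). frag_of (m, ract N n a))"
  have "(\<Union>d \<in> tensor_class S M N c. tensor_class S M N (?h d)) = tensor_class S M N (?h c)"
  proof (rule tensor_class_map[OF MN, where f = "\<lambda>m. m" and g = "\<lambda>n. ract N n a"])
    fix r assume "r \<in> tensor_relators S M N"
    then show "?h r \<in> tensor_relators S M N"
    proof (cases rule: tensor_relators_cases)
      case (l m m' n)
      then show ?thesis
        using tensor_relatorsI(1)[of m M m' "ract N n a" N S] a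
        by (simp add: frag_extend_diff N.ract_closed)
    next
      case (r m n n')
      then show ?thesis
        using tensor_relatorsI(2)[of m M "ract N n a" N "ract N n' a" S] a
        by (simp add: frag_extend_diff N.ract_add_left N.ract_closed)
    next
      case (b m s n)
      then show ?thesis
        using tensor_relatorsI(3)[of m M s S "ract N n a" N] a
        by (simp add: frag_extend_diff N.ract_closed N.lact_ract)
    qed
  qed (use a c N.ract_closed in auto)
  then show ?thesis
    by (simp add: tensor_def Let_def)
qed

lemma frag_eval_hom:
  assumes "abelian_group P" and "\<And>m n. m \<in> X \<Longrightarrow> n \<in> Y \<Longrightarrow> \<phi> m n \<in> carrier P"
  shows "frag_eval P \<phi> \<in> hom (free_Abelian_group (X \<times> Y)) (add_monoid P)"
proof -
  interpret P: abelian_group P by fact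
  have cl: "\<phi> (fst k) (snd k) \<in> carrier P" if "k \<in> X \<times> Y" for k
    using that assms(2) by auto
  have zero0: "[(0::int)] \<cdot>\<^bsub>P\<^esub> x = \<zero>\<^bsub>P\<^esub>" for x
    by (simp add: add_pow_def)
  have eval: "frag_eval P \<phi> c =
      (\<Oplus>\<^bsub>P\<^esub>k \<in> S. [Poly_Mapping.lookup c k] \<cdot>\<^bsub>P\<^esub> \<phi> (fst k) (snd k))"
    if "Poly_Mapping.keys c \<subseteq> S" "finite S" "S \<subseteq> X \<times> Y" for c S
    unfolding frag_eval_def
    by (rule P.add.finprod_mono_neutral_cong_left)
      (use that cl in \<open>auto simp: in_keys_iff zero0\<close>)
  show ?thesis
  proof (rule homI)
    fix c assume "c \<in> carrier (free_Abelian_group (X \<times> Y))"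
    then show "frag_eval P \<phi> c \<in> carrier (add_monoid P)"
      using cl by (auto simp: frag_eval_def free_Abelian_group_def intro!: P.finsum_closed)
  next
    fix c d
    assume cd: "c \<in> carrier (free_Abelian_group (X \<times> Y))"
      "d \<in> carrier (free_Abelian_group (X \<times> Y))"
    let ?S = "Poly_Mapping.keys c \<union> Poly_Mapping.keys d"
    have S: "finite ?S" "?S \<subseteq> X \<times> Y"
      using cd by (auto simp: free_Abelian_group_def)
    have "frag_eval P \<phi> (c + d) =
        (\<Oplus>\<^bsub>P\<^esub>k \<in> ?S. [Poly_Mapping.lookup (c + d) k] \<cdot>\<^bsub>P\<^esub> \<phi> (fst k) (snd k))"
      by (rule eval[OF _ S]) (rule Poly_Mapping.keys_add)
    also have "\<dots> = (\<Oplus>\<^bsub>P\<^esub>k \<in> ?S. [Poly_Mapping.lookup c k] \<cdot>\<^bsub>P\<^esub> \<phi> (fst k) (snd k) \<oplus>\<^bsub>P\<^esub>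
        [Poly_Mapping.lookup d k] \<cdot>\<^bsub>P\<^esub> \<phi> (fst k) (snd k))"
      using S(2) cl by (intro P.finsum_cong') (auto simp: lookup_add P.add.int_pow_mult)
    also have "\<dots> = frag_eval P \<phi> c \<oplus>\<^bsub>P\<^esub> frag_eval P \<phi> d"
      using S cl by (subst (1 2) eval[OF _ S]) (auto intro!: P.finsum_addf)
    finally show "frag_eval P \<phi> (c \<otimes>\<^bsub>free_Abelian_group (X \<times> Y)\<^esub> d) =
        frag_eval P \<phi> c \<otimes>\<^bsub>add_monoid P\<^esub> frag_eval P \<phi> d"
      by simp
  qed
qed

lemma tensor_lift_class:
  assumes P: "abelian_group P" and S: "bimodule L S M" and N: "bimodule S R N"
    and cl: "\<And>m n. m \<in> carrier M \<Longrightarrow> n \<in> carrier N \<Longrightarrow> \<phi> m n \<in> carrier P"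
    and add_l: "\<And>m m' n. m \<in> carrier M \<Longrightarrow> m' \<in> carrier M \<Longrightarrow> n \<in> carrier N \<Longrightarrow>
      \<phi> (m \<oplus>\<^bsub>M\<^esub> m') n = \<phi> m n \<oplus>\<^bsub>P\<^esub> \<phi> m' n"
    and add_r: "\<And>m n n'. m \<in> carrier M \<Longrightarrow> n \<in> carrier N \<Longrightarrow> n' \<in> carrier N \<Longrightarrow>
      \<phi> m (n \<oplus>\<^bsub>N\<^esub> n') = \<phi> m n \<oplus>\<^bsub>P\<^esub> \<phi> m n'"
    and balanced: "\<And>m s n. m \<in> carrier M \<Longrightarrow> s \<in> carrier S \<Longrightarrow> n \<in> carrier N \<Longrightarrow>
      \<phi> (ract M m s) n = \<phi> m (lact N s n)"
    and c: "c \<in> carrier (tensor_gens M N)"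
  shows "tensor_lift P \<phi> (tensor_class S M N c) = frag_eval P \<phi> c"
proof -
  interpret P: abelian_group P by fact
  interpret M: bimodule L S M by fact
  interpret N: bimodule S R N by fact
  let ?F = "tensor_gens M N" and ?e = "frag_eval P \<phi>"
  interpret e: group_hom ?F "add_monoid P" ?e
    by (intro group_hom.intro group_hom_axioms.intro frag_eval_hom P cl
        group_free_Abelian_group P.a_group)
  have of: "frag_of (m, n) \<in> carrier ?F" "?e (frag_of (m, n)) = \<phi> m n"
    if "m \<in> carrier M" "n \<in> carrier N" for m n
    using that cl by (auto simp: frag_eval_def keys_frag_of)
  have diff: "x - y \<in> carrier ?F" "?e (x - y) = ?e x \<ominus>\<^bsub>P\<^esub> ?e y"
    if x: "x \<in> carrier ?F" and y: "y \<in> carrier ?F" for x y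
  proof -
    have ivy: "inv\<^bsub>?F\<^esub> y = - y"
      using y by (simp add: carrier_free_Abelian_group_iff)
    have my: "- y \<in> carrier ?F"
      using y by (simp add: carrier_free_Abelian_group_iff)
    have eq: "x - y = x \<otimes>\<^bsub>?F\<^esub> (- y)"
      by simp
    show "x - y \<in> carrier ?F"
      unfolding eq using x my by (rule e.m_closed)
    have "?e (x - y) = ?e x \<oplus>\<^bsub>P\<^esub> ?e (- y)"
      unfolding eq using e.hom_mult[OF x my] by simp
    moreover have "?e (- y) = \<ominus>\<^bsub>P\<^esub> ?e y"
      using e.hom_inv[OF y] ivy by (simp add: a_inv_def)
    ultimately show "?e (x - y) = ?e x \<ominus>\<^bsub>P\<^esub> ?e y"
      by (simp add: a_minus_def)
  qed
  have cancel: "x \<oplus>\<^bsub>P\<^esub> y \<ominus>\<^bsub>P\<^esub> x \<ominus>\<^bsub>P\<^esub> y = \<zero>\<^bsub>P\<^esub>" if "x \<in> carrier P" "y \<in> carrier P" for x y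
  proof -
    have "x \<oplus>\<^bsub>P\<^esub> y \<ominus>\<^bsub>P\<^esub> x \<ominus>\<^bsub>P\<^esub> y = (x \<oplus>\<^bsub>P\<^esub> y) \<oplus>\<^bsub>P\<^esub> \<ominus>\<^bsub>P\<^esub> (x \<oplus>\<^bsub>P\<^esub> y)"
      using that by (simp add: a_minus_def P.a_assoc P.minus_add)
    then show ?thesis
      using that by (simp add: P.r_neg)
  qed
  have gen: "h \<in> carrier ?F \<and> ?e h = \<zero>\<^bsub>P\<^esub>" if "h \<in> tensor_relators S M N" for h
  proof -
    show ?thesis
      using that
    proof (cases rule: tensor_relators_cases)
      case (l m m' n)
      have mm: "m \<oplus>\<^bsub>M\<^esub> m' \<in> carrier M" using l by (intro M.add.m_closed)
      note mem = of(1)[OF mm l(3)] of(1)[OF l(1,3)] of(1)[OF l(2,3)]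
      have "?e h = \<phi> (m \<oplus>\<^bsub>M\<^esub> m') n \<ominus>\<^bsub>P\<^esub> \<phi> m n \<ominus>\<^bsub>P\<^esub> \<phi> m' n"
        unfolding l(4) diff(2)[OF diff(1)[OF mem(1,2)] mem(3)] diff(2)[OF mem(1,2)]
          of(2)[OF mm l(3)] of(2)[OF l(1,3)] of(2)[OF l(2,3)] ..
      then show ?thesis
        using diff(1)[OF diff(1)[OF mem(1,2)] mem(3)] l(4) cancel[OF cl[OF l(1,3)] cl[OF l(2,3)]]
        unfolding add_l[OF l(1-3)] by metis
    next
      case (r m n n')
      have nn: "n \<oplus>\<^bsub>N\<^esub> n' \<in> carrier N" using r by (intro N.add.m_closed)
      note mem = of(1)[OF r(1) nn] of(1)[OF r(1,2)] of(1)[OF r(1,3)]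
      have "?e h = \<phi> m (n \<oplus>\<^bsub>N\<^esub> n') \<ominus>\<^bsub>P\<^esub> \<phi> m n \<ominus>\<^bsub>P\<^esub> \<phi> m n'"
        unfolding r(4) diff(2)[OF diff(1)[OF mem(1,2)] mem(3)] diff(2)[OF mem(1,2)]
          of(2)[OF r(1) nn] of(2)[OF r(1,2)] of(2)[OF r(1,3)] ..
      then show ?thesis
        using diff(1)[OF diff(1)[OF mem(1,2)] mem(3)] r(4) cancel[OF cl[OF r(1,2)] cl[OF r(1,3)]]
        unfolding add_r[OF r(1-3)] by metis
    next
      case (b m s n)
      have ms: "ract M m s \<in> carrier M" "lact N s n \<in> carrier N"
        using b by (auto intro: M.ract_closed N.lact_closed)
      note mem = of(1)[OF ms(1) b(3)] of(1)[OF b(1) ms(2)]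
      have "?e h = \<phi> (ract M m s) n \<ominus>\<^bsub>P\<^esub> \<phi> m (lact N s n)"
        unfolding b(4) diff(2)[OF mem] of(2)[OF ms(1) b(3)] of(2)[OF b(1) ms(2)] ..
      then show ?thesis
        using diff(1)[OF mem] b(4) P.r_neg[OF cl[OF b(1) ms(2)]]
        unfolding balanced[OF b(1-3)] a_minus_def by metis
    qed
  qed
  have rels: "r \<in> carrier ?F \<and> ?e r = \<zero>\<^bsub>P\<^esub>" if "r \<in> tensor_rels S M N" for r
    using that unfolding tensor_rels_def
  proof (induction rule: generate.induct)
    case one then show ?case using e.hom_one by simp
  next
    case (incl h) then show ?case by (rule gen)
  next
    case (inv h) then show ?case using gen[OF inv] e.hom_inv[of h] group.inv_closed[OF group_free_Abelian_group]
      by (metis P.add.inv_one monoid.select_convs(2))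
  next
    case (eng h1 h2)
    then have "h1 \<otimes>\<^bsub>?F\<^esub> h2 \<in> carrier ?F" "?e (h1 \<otimes>\<^bsub>?F\<^esub> h2) = ?e h1 \<oplus>\<^bsub>P\<^esub> ?e h2"
      using e.m_closed[of h1 h2] e.hom_mult[of h1 h2] by auto
    with eng show ?case by simp
  qed
  have zero: "0 \<in> tensor_rels S M N"
    unfolding tensor_rels_def using generate.one[of ?F] by simp
  have "?e ` tensor_class S M N c = {?e c}"
  proof -
    have "?e x = ?e c" if "x \<in> tensor_class S M N c" for x
      using that rels e.hom_mult[OF _ c] cl
      by (force simp: tensor_class_def r_coset_def e.hom_closed[OF c, simplified])
    moreover have "c \<in> tensor_class S M N c"
      using zero unfolding tensor_class_def r_coset_def by force
    ultimately show ?thesis by blast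
  qed
  then show ?thesis
    by (simp add: tensor_lift_def)
qed


section \<open>Depth two extensions\<close>

text \<open>The ring \<open>B\<close> is \<open>A\<lparr>carrier := B\<rparr>\<close>.\<close>

definition tensor_square ::
    "('a, 'x) ring_scheme \<Rightarrow> 'a set \<Rightarrow> ('a, 'a, ('a \<times> 'a \<Rightarrow>\<^sub>0 int) set) bimodule"
  where "tensor_square A B = tensor (A\<lparr>carrier := B\<rparr>) (regular_bimodule A) (regular_bimodule A)"

definition depth_two :: "('a, 'x) ring_scheme \<Rightarrow> 'a set \<Rightarrow> bool"
  where "depth_two A B \<longleftrightarrow> (\<exists>N>0.
    iso_to_direct_summand (A\<lparr>carrier := B\<rparr>) A
      (tensor_square A B) (power_bimodule (regular_bimodule A) N) \<and>
    iso_to_direct_summand A (A\<lparr>carrier := B\<rparr>)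
      (tensor_square A B) (power_bimodule (regular_bimodule A) N))"

definition irreducible_extension :: "('a, 'x) ring_scheme \<Rightarrow> 'a set \<Rightarrow> bool"
  where "irreducible_extension A B \<longleftrightarrow>
    depth_two A B \<and> centralized B (regular_bimodule A) \<subseteq> B"

definition T_set :: "('a, 'x) ring_scheme \<Rightarrow> 'a set \<Rightarrow> ('a \<times> 'a \<Rightarrow>\<^sub>0 int) set set"
  where "T_set A B = centralized B (tensor_square A B)"

definition Hom_BB ::
    "('a, 'x) ring_scheme \<Rightarrow> 'a set \<Rightarrow> ('a, 'a, 'p, 'z) bimodule_scheme \<Rightarrow> ('a \<Rightarrow> 'p) set"
  where "Hom_BB A B P =
    bimod_hom (A\<lparr>carrier := B\<rparr>) (A\<lparr>carrier := B\<rparr>) (regular_bimodule A) P"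

text \<open>\<open>lmul A P p\<close> and \<open>rmul A P p\<close> are \<open>\<lambda>\<^sub>p\<close>: \<open>a \<mapsto> p a\<close> and \<open>\<rho>\<^sub>p\<close>: \<open>a \<mapsto> a p\<close>; thus left multiplication by \<open>p\<close>
  uses the right action on \<open>P\<close>.\<close>

definition lmul :: "('a, 'x) ring_scheme \<Rightarrow> ('a, 'a, 'p, 'z) bimodule_scheme \<Rightarrow> 'p \<Rightarrow> 'a \<Rightarrow> 'p"
  where "lmul A P p = (\<lambda>a\<in>carrier A. ract P p a)"

definition rmul :: "('a, 'x) ring_scheme \<Rightarrow> ('a, 'a, 'p, 'z) bimodule_scheme \<Rightarrow> 'p \<Rightarrow> 'a \<Rightarrow> 'p"
  where "rmul A P p = (\<lambda>a\<in>carrier A. lact P a p)"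

lemma lmul_rmul_in_Hom_BB:
  assumes "bimodule A A P" and B: "B \<subseteq> carrier A" and p: "p \<in> centralized B P"
  shows "lmul A P p \<in> Hom_BB A B P" "rmul A P p \<in> Hom_BB A B P"
proof -
  interpret P: bimodule A A P by fact
  have pc: "p \<in> carrier P" and com: "\<And>b. b \<in> B \<Longrightarrow> lact P b p = ract P p b"
    using p by (auto simp: centralized_def)
  have Bc: "\<And>b. b \<in> B \<Longrightarrow> b \<in> carrier A" using B by blast
  show "lmul A P p \<in> Hom_BB A B P"
    using pc Bc
    by (auto simp: Hom_BB_def bimod_hom_def lmul_def regular_bimodule_def P.ract_closed
        P.ract_add_right P.ract_mult P.lact_ract[symmetric] com)
  show "rmul A P p \<in> Hom_BB A B P"
    using pc Bc
    by (auto simp: Hom_BB_def bimod_hom_def rmul_def regular_bimodule_def P.lact_closed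
        P.lact_add_left P.lact_mult P.lact_ract com)
qed

text \<open>The pairings \<open>\<langle>\<alpha>, t\<rangle>\<close> and \<open>[u, \<beta>]\<close>.\<close>

definition angle_pairing ::
    "('a, 'a, 'p, 'z) bimodule_scheme \<Rightarrow> ('a \<Rightarrow> 'p) \<Rightarrow> ('a \<times> 'a \<Rightarrow>\<^sub>0 int) set \<Rightarrow> 'p"
  where "angle_pairing P \<alpha> t = tensor_lift P (\<lambda>x y. ract P (\<alpha> x) y) t"

definition square_pairing ::
    "('a, 'a, 'p, 'z) bimodule_scheme \<Rightarrow> ('a \<times> 'a \<Rightarrow>\<^sub>0 int) set \<Rightarrow> ('a \<Rightarrow> 'p) \<Rightarrow> 'p"
  where "square_pairing P u \<beta> = tensor_lift P (\<lambda>x y. lact P x (\<beta> y)) u"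

definition sigma ::
    "('a, 'x) ring_scheme \<Rightarrow> 'a set \<Rightarrow> ('a, 'a, 'p, 'z) bimodule_scheme \<Rightarrow>
     ('a \<Rightarrow> 'p) \<Rightarrow> 'a \<Rightarrow> 'p"
  where "sigma A B P \<alpha> = (THE \<alpha>'. \<alpha>' \<in> Hom_BB A B P \<and>
    (\<forall>t \<in> T_set A B. angle_pairing P \<alpha> t = square_pairing P t \<alpha>'))"

end

theory Submission
  imports Defs
begin

text \<open>Splitting \<open>A \<otimes>\<^sub>B A\<close> off \<open>A\<^sup>N\<close> gives quasibases \<open>t\<^sub>i, u\<^sub>j \<in> T\<close> and \<open>B\<close>-\<open>B\<close>-bilinear
  \<open>\<beta>\<^sub>i, \<gamma>\<^sub>j : A \<rightarrow> A\<close> with \<open>x \<otimes> 1 = \<Sum> t\<^sub>i \<beta>\<^sub>i(x)\<close> and \<open>1 \<otimes> y = \<Sum> \<gamma>\<^sub>j(y) u\<^sub>j\<close>. Applying the pairings yields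
  \<open>\<alpha>(x) = \<Sum> \<langle>\<alpha>, t\<^sub>i\<rangle> \<beta>\<^sub>i(x) = \<Sum> \<gamma>\<^sub>j(x) [u\<^sub>j, \<alpha>]\<close>, whence nondegeneracy. For \<open>t \<in> T\<close> the elements
  \<open>t\<^sup>1 \<gamma>\<^sub>j(t\<^sup>2)\<close> and \<open>\<beta>\<^sub>i(t\<^sup>1) t\<^sup>2\<close> centralize \<open>B\<close>, hence lie in \<open>B\<close> by irreducibility, and so
  \<open>\<alpha>\<^sup>\<sigma>(a) = \<Sum> \<gamma>\<^sub>j(a) \<langle>\<alpha>, u\<^sub>j\<rangle>\<close>, with inverse \<open>\<beta> \<mapsto> (a \<mapsto> \<Sum> [t\<^sub>i, \<beta>] \<beta>\<^sub>i(a))\<close>.\<close>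


section \<open>Additive maps and finite sums\<close>

text \<open>Unlike \<open>bimod_hom\<close>, these maps are not extensional, so pairings, actions
  and their composites can be written as plain lambda terms.\<close>

abbreviation add_hom :: "('m, 'x) ring_scheme \<Rightarrow> ('n, 'y) ring_scheme \<Rightarrow> ('m \<Rightarrow> 'n) set"
  where "add_hom M N \<equiv> hom (add_monoid M) (add_monoid N)"

lemma add_homI:
  assumes "\<And>m. m \<in> carrier M \<Longrightarrow> h m \<in> carrier N"
    and "\<And>m m'. m \<in> carrier M \<Longrightarrow> m' \<in> carrier M \<Longrightarrow> h (m \<oplus>\<^bsub>M\<^esub> m') = h m \<oplus>\<^bsub>N\<^esub> h m'"
  shows "h \<in> add_hom M N"
  using assms by (auto intro: homI)

lemma add_hom_closed: "h \<in> add_hom M N \<Longrightarrow> m \<in> carrier M \<Longrightarrow> h m \<in> carrier N"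
  by (auto simp: hom_def)

lemma add_hom_add:
  "h \<in> add_hom M N \<Longrightarrow> m \<in> carrier M \<Longrightarrow> m' \<in> carrier M \<Longrightarrow> h (m \<oplus>\<^bsub>M\<^esub> m') = h m \<oplus>\<^bsub>N\<^esub> h m'"
  by (auto simp: hom_def)

lemma add_hom_compose:
  "f \<in> add_hom L M \<Longrightarrow> g \<in> add_hom M N \<Longrightarrow> (\<lambda>x. g (f x)) \<in> add_hom L N"
  by (auto intro!: add_homI simp: add_hom_closed add_hom_add)

lemma add_hom_zero:
  assumes "abelian_group M" and "abelian_group N" and "h \<in> add_hom M N"
  shows "h \<zero>\<^bsub>M\<^esub> = \<zero>\<^bsub>N\<^esub>"
proof -
  interpret h: group_hom "add_monoid M" "add_monoid N" h
    by (intro group_hom.intro group_hom_axioms.intro abelian_group.a_group assms)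
  show ?thesis using h.hom_one by simp
qed

lemma add_hom_finsum:
  assumes "abelian_group M" and "abelian_group N" and h: "h \<in> add_hom M N"
    and f: "\<And>i. i \<in> I \<Longrightarrow> f i \<in> carrier M"
  shows "h (\<Oplus>\<^bsub>M\<^esub>i \<in> I. f i) = (\<Oplus>\<^bsub>N\<^esub>i \<in> I. h (f i))"
proof -
  interpret M: abelian_group M by fact
  interpret N: abelian_group N by fact
  note zero = add_hom_zero[OF assms(1-3)]
  show ?thesis
    using f
  proof (induction I rule: infinite_finite_induct)
    \<comment> \<open>Over an infinite index set both sums take the default value zero, which
      \<open>h\<close> preserves.\<close>
    case (infinite I)
    then show ?case by (simp add: M.add.finprod_infinite N.add.finprod_infinite zero)
  next
    case empty
    then show ?case by (simp add: zero)
  next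
    case (insert i I)
    then show ?case
      by (simp add: M.finsum_insert N.finsum_insert Pi_def add_hom_add[OF h] add_hom_closed[OF h])
  qed
qed

lemma add_hom_sum:
  assumes "abelian_group N" and h: "\<And>i. i \<in> I \<Longrightarrow> h i \<in> add_hom M N"
  shows "(\<lambda>m. \<Oplus>\<^bsub>N\<^esub>i \<in> I. h i m) \<in> add_hom M N"
proof -
  interpret N: abelian_group N by fact
  show ?thesis
    by (rule add_homI)
      (auto simp: add_hom_closed[OF h] add_hom_add[OF h] N.finsum_addf Pi_def
        intro!: N.finsum_closed cong: N.finsum_cong)
qed


text \<open>For comparing two decompositions of one element: if \<open>x\<close>, \<open>x'\<close>
  lie in one subgroup and \<open>y\<close>, \<open>y'\<close> in another, the common difference lies
  in both.\<close>

lemma (in abelian_group) diff_eq_diffI: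
  assumes "x \<in> carrier G" "y \<in> carrier G" "x' \<in> carrier G" "y' \<in> carrier G"
    and eq: "x \<oplus> y = x' \<oplus> y'"
  shows "x \<oplus> \<ominus> x' = y' \<oplus> \<ominus> y"
proof -
  have "x \<oplus> \<ominus> x' = (x \<oplus> y) \<oplus> (\<ominus> y \<oplus> \<ominus> x')"
    using assms(1-4) by (simp add: a_assoc r_neg2)
  also have "\<dots> = (y' \<oplus> x') \<oplus> (\<ominus> x' \<oplus> \<ominus> y)"
    unfolding eq using assms(1-4) by (simp add: a_comm)
  also have "\<dots> = y' \<oplus> \<ominus> y"
    using assms(1-4) by (simp add: a_assoc r_neg2)
  finally show ?thesis .
qed


section \<open>Bimodules\<close>

context bimodule
begin

lemma lact_add_hom: "a \<in> carrier L \<Longrightarrow> lact M a \<in> add_hom M M"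
  by (intro add_homI lact_closed lact_add_right)

lemma ract_add_hom: "r \<in> carrier R \<Longrightarrow> (\<lambda>m. ract M m r) \<in> add_hom M M"
  by (intro add_homI ract_closed ract_add_left)

lemma lact_scalar_add_hom: "m \<in> carrier M \<Longrightarrow> (\<lambda>a. lact M a m) \<in> add_hom L M"
  by (intro add_homI lact_closed lact_add_left)

lemma ract_scalar_add_hom: "m \<in> carrier M \<Longrightarrow> ract M m \<in> add_hom R M"
  by (intro add_homI ract_closed ract_add_right)

lemma restrict_scalars:
  assumes "subring L' L" and "subring R' R"
  shows "bimodule (L\<lparr>carrier := L'\<rparr>) (R\<lparr>carrier := R'\<rparr>) M"
proof -
  have L': "a \<in> carrier L" if "a \<in> L'" for a
    using subringE(1)[OF assms(1)] that by blast
  have R': "a \<in> carrier R" if "a \<in> R'" for a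
    using subringE(1)[OF assms(2)] that by blast
  show ?thesis
    by (intro bimodule.intro bimodule_axioms.intro L.subring_is_ring R.subring_is_ring assms
        M.abelian_group_axioms)
      (simp_all add: L' R' lact_closed lact_add_left lact_add_right lact_mult lact_one
        ract_closed ract_add_left ract_add_right ract_mult ract_one lact_ract)
qed

end

section \<open>The regular bimodule and bimodule homomorphisms\<close>

lemma bimodule_regular:
  assumes "ring A"
  shows "bimodule A A (regular_bimodule A)"
proof -
  interpret ring A by fact
  have "abelian_group (regular_bimodule A)"
    by (rule abelian_groupI) (auto simp: regular_bimodule_def a_ac intro: add.l_inv_ex)
  then show ?thesis
    by (intro bimodule.intro bimodule_axioms.intro assms)
      (auto simp: regular_bimodule_def l_distr r_distr m_assoc)
qed

lemma regular_bimodule_simps [simp]: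
  "carrier (regular_bimodule A) = carrier A" "\<zero>\<^bsub>regular_bimodule A\<^esub> = \<zero>\<^bsub>A\<^esub>"
  "x \<oplus>\<^bsub>regular_bimodule A\<^esub> y = x \<oplus>\<^bsub>A\<^esub> y"
  "lact (regular_bimodule A) x y = x \<otimes>\<^bsub>A\<^esub> y" "ract (regular_bimodule A) x y = x \<otimes>\<^bsub>A\<^esub> y"
  by (simp_all add: regular_bimodule_def)

lemma bimod_homI:
  assumes "\<And>m. m \<in> carrier M \<Longrightarrow> f m \<in> carrier N" and "\<And>m. m \<notin> carrier M \<Longrightarrow> f m = undefined"
    and "\<And>m n. m \<in> carrier M \<Longrightarrow> n \<in> carrier M \<Longrightarrow> f (m \<oplus>\<^bsub>M\<^esub> n) = f m \<oplus>\<^bsub>N\<^esub> f n"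
    and "\<And>a m. a \<in> carrier L \<Longrightarrow> m \<in> carrier M \<Longrightarrow> f (lact M a m) = lact N a (f m)"
    and "\<And>m a. m \<in> carrier M \<Longrightarrow> a \<in> carrier R \<Longrightarrow> f (ract M m a) = ract N (f m) a"
  shows "f \<in> bimod_hom L R M N"
  using assms by (auto simp: bimod_hom_def)

lemma bimod_homD:
  assumes "f \<in> bimod_hom L R M N"
  shows "m \<in> carrier M \<Longrightarrow> f m \<in> carrier N"
    and "m \<notin> carrier M \<Longrightarrow> f m = undefined"
    and "m \<in> carrier M \<Longrightarrow> n \<in> carrier M \<Longrightarrow> f (m \<oplus>\<^bsub>M\<^esub> n) = f m \<oplus>\<^bsub>N\<^esub> f n"
    and "a \<in> carrier L \<Longrightarrow> m \<in> carrier M \<Longrightarrow> f (lact M a m) = lact N a (f m)"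
    and "m \<in> carrier M \<Longrightarrow> r \<in> carrier R \<Longrightarrow> f (ract M m r) = ract N (f m) r"
  using assms by (auto simp: bimod_hom_def)

lemma bimod_hom_add_hom: "f \<in> bimod_hom L R M N \<Longrightarrow> f \<in> add_hom M N"
  by (rule add_homI[OF bimod_homD(1,3)])

text \<open>The retraction \<open>g\<close> projects onto \<open>S\<close> along the complement
  \<open>S'\<close> and then inverts \<open>f\<close>. Depth two is used below only in this form, as
  a split injection.\<close>

lemma iso_to_direct_summand_retract:
  fixes M :: "('l, 'r, 'm, 'z) bimodule_scheme" and N :: "('l, 'r, 'n, 'w) bimodule_scheme"
  assumes "bimodule L R M" and "bimodule L R N" and "iso_to_direct_summand L R M N"
  obtains f g where "f \<in> bimod_hom L R M N" and "g \<in> bimod_hom L R N M"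
    and "\<And>m. m \<in> carrier M \<Longrightarrow> g (f m) = m"
proof -
  interpret M: bimodule L R M by fact
  interpret N: bimodule L R N by fact
  obtain S S' f where S: "subbimodule S L R N" and S': "subbimodule S' L R N"
    and sum: "S <+>\<^bsub>N\<^esub> S' = carrier N" and int: "S \<inter> S' = {\<zero>\<^bsub>N\<^esub>}"
    and f: "f \<in> bimod_hom L R M (N\<lparr>carrier := S\<rparr>)" and bij: "bij_betw f (carrier M) S"
    using assms(3) unfolding iso_to_direct_summand_def direct_summand_def by blast
  interpret S: subgroup S "add_monoid N" using S by (simp add: subbimodule_def)
  interpret S': subgroup S' "add_monoid N" using S' by (simp add: subbimodule_def)
  have sub: "x \<in> carrier N" if "x \<in> S \<or> x \<in> S'" for x
    using that S.subset S'.subset by auto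
  note fD = bimod_homD[OF f, simplified]
  have fcl: "f m \<in> carrier N" if "m \<in> carrier M" for m
    using fD(1)[OF that] sub by blast
  have ex: "\<exists>m s. m \<in> carrier M \<and> s \<in> S' \<and> n = f m \<oplus>\<^bsub>N\<^esub> s" if "n \<in> carrier N" for n
  proof -
    have "n \<in> S <+>\<^bsub>N\<^esub> S'" using that sum by simp
    then obtain s s' where "s \<in> S" "s' \<in> S'" "n = s \<oplus>\<^bsub>N\<^esub> s'"
      by (auto simp: set_add_def')
    moreover from this obtain m where "m \<in> carrier M" "s = f m"
      using bij unfolding bij_betw_def by auto
    ultimately show ?thesis by blast
  qed
  \<comment> \<open>The difference of the two \<open>S\<close> parts equals a difference of
    \<open>S'\<close> parts, so it lies in \<open>S \<inter> S'\<close> and vanishes; injectivity of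
    \<open>f\<close> does the rest.\<close>
  have unique: "m = m'"
    if m: "m \<in> carrier M" "m' \<in> carrier M" and s: "s \<in> S'" "s' \<in> S'"
      and eq: "f m \<oplus>\<^bsub>N\<^esub> s = f m' \<oplus>\<^bsub>N\<^esub> s'" for m m' s s'
  proof -
    have "f m \<oplus>\<^bsub>N\<^esub> \<ominus>\<^bsub>N\<^esub> f m' = s' \<oplus>\<^bsub>N\<^esub> \<ominus>\<^bsub>N\<^esub> s"
      using eq fcl m s sub by (intro N.M.diff_eq_diffI) auto
    moreover have "f m \<oplus>\<^bsub>N\<^esub> \<ominus>\<^bsub>N\<^esub> f m' \<in> S"
      using S.m_closed[OF fD(1)[OF m(1)] S.m_inv_closed[OF fD(1)[OF m(2)]]] by (simp add: a_inv_def)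
    moreover have "s' \<oplus>\<^bsub>N\<^esub> \<ominus>\<^bsub>N\<^esub> s \<in> S'"
      using S'.m_closed[OF s(2) S'.m_inv_closed[OF s(1)]] by (simp add: a_inv_def)
    ultimately have "f m \<oplus>\<^bsub>N\<^esub> \<ominus>\<^bsub>N\<^esub> f m' = \<zero>\<^bsub>N\<^esub>"
      using int by auto
    then have "f m = f m'"
      using fcl[OF m(1)] fcl[OF m(2)] by (metis N.M.minus_equality N.M.minus_minus N.M.a_inv_closed)
    then show ?thesis
      using bij m unfolding bij_betw_def inj_on_def by blast
  qed
  \<comment> \<open>By \<open>unique\<close> the chosen \<open>m\<close> is the only candidate, so
    \<open>SOME\<close> involves no real choice.\<close>
  define g where "g = (\<lambda>n \<in> carrier N. SOME m. m \<in> carrier M \<and> (\<exists>s \<in> S'. n = f m \<oplus>\<^bsub>N\<^esub> s))"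
  have g: "g n \<in> carrier M \<and> (\<exists>s \<in> S'. n = f (g n) \<oplus>\<^bsub>N\<^esub> s)" if "n \<in> carrier N" for n
    using someI_ex[of "\<lambda>m. m \<in> carrier M \<and> (\<exists>s \<in> S'. n = f m \<oplus>\<^bsub>N\<^esub> s)"] ex[OF that] that
    unfolding g_def by auto
  \<comment> \<open>Linearity of \<open>g\<close> is proved by writing down a decomposition of the
    argument and reading off its first component with this rule.\<close>
  have g_eq: "g (f m \<oplus>\<^bsub>N\<^esub> s) = m" if "m \<in> carrier M" "s \<in> S'" for m s
    using g[of "f m \<oplus>\<^bsub>N\<^esub> s"] unique that sub fcl by (metis N.M.a_closed)
  show thesis
  proof
    show "f \<in> bimod_hom L R M N"
      using fD fcl by (intro bimod_homI) auto
    show "g \<in> bimod_hom L R N M"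
    proof (rule bimod_homI)
      fix n n' assume n: "n \<in> carrier N" and n': "n' \<in> carrier N"
      obtain s s' where s: "s \<in> S'" "n = f (g n) \<oplus>\<^bsub>N\<^esub> s" "s' \<in> S'" "n' = f (g n') \<oplus>\<^bsub>N\<^esub> s'"
        using g n n' by metis
      have "n \<oplus>\<^bsub>N\<^esub> n' = (f (g n) \<oplus>\<^bsub>N\<^esub> s) \<oplus>\<^bsub>N\<^esub> (f (g n') \<oplus>\<^bsub>N\<^esub> s')"
        using s by simp
      also have "\<dots> = f (g n \<oplus>\<^bsub>M\<^esub> g n') \<oplus>\<^bsub>N\<^esub> (s \<oplus>\<^bsub>N\<^esub> s')"
        using g[OF n] g[OF n'] s(1,3) sub fcl by (simp add: fD N.M.a_ac)
      finally show "g (n \<oplus>\<^bsub>N\<^esub> n') = g n \<oplus>\<^bsub>M\<^esub> g n'"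
        using g[OF n] g[OF n'] S'.m_closed[OF s(1,3)] by (simp add: g_eq)
    next
      fix a n assume a: "a \<in> carrier L" and n: "n \<in> carrier N"
      obtain s where s: "s \<in> S'" "n = f (g n) \<oplus>\<^bsub>N\<^esub> s"
        using g n by metis
      have "lact N a n = lact N a (f (g n) \<oplus>\<^bsub>N\<^esub> s)"
        using s by simp
      also have "\<dots> = f (lact M a (g n)) \<oplus>\<^bsub>N\<^esub> lact N a s"
        using g[OF n] s(1) sub fcl a by (simp add: fD N.lact_add_right)
      finally show "g (lact N a n) = lact M a (g n)"
        using g[OF n] s(1) S' a by (simp add: g_eq M.lact_closed subbimodule_def)
    next
      fix a n assume a: "a \<in> carrier R" and n: "n \<in> carrier N"
      obtain s where s: "s \<in> S'" "n = f (g n) \<oplus>\<^bsub>N\<^esub> s"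
        using g n by metis
      have "ract N n a = ract N (f (g n) \<oplus>\<^bsub>N\<^esub> s) a"
        using s by simp
      also have "\<dots> = f (ract M (g n) a) \<oplus>\<^bsub>N\<^esub> ract N s a"
        using g[OF n] s(1) sub fcl a by (simp add: fD N.ract_add_left)
      finally show "g (ract N n a) = ract M (g n) a"
        using g[OF n] s(1) S' a by (simp add: g_eq M.ract_closed subbimodule_def)
    qed (use g in \<open>auto simp: g_def\<close>)
    \<comment> \<open>Here \<open>f m\<close> is decomposed with \<open>S'\<close> part
      zero.\<close>
    show "g (f m) = m" if "m \<in> carrier M" for m
      using g_eq[OF that, of "\<zero>\<^bsub>N\<^esub>"] int fcl[OF that] by auto
  qed
qed

section \<open>Finite powers of a bimodule\<close>

lemma bimodule_power:
  assumes "bimodule L R M"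
  shows "bimodule L R (power_bimodule M N)"
proof -
  interpret M: bimodule L R M by fact
  have "abelian_group (power_bimodule M N)"
  proof (rule abelian_groupI)
    fix x assume x: "x \<in> carrier (power_bimodule M N)"
    then show "\<exists>y \<in> carrier (power_bimodule M N). y \<oplus>\<^bsub>power_bimodule M N\<^esub> x = \<zero>\<^bsub>power_bimodule M N\<^esub>"
      by (intro bexI[of _ "\<lambda>i\<in>{..<N}. \<ominus>\<^bsub>M\<^esub> x i"])
        (auto simp: power_bimodule_def fun_eq_iff M.M.l_neg PiE_iff)
  qed (auto simp: power_bimodule_def fun_eq_iff M.M.a_ac PiE_iff extensional_def)
  then show ?thesis
    by (intro bimodule.intro bimodule_axioms.intro M.L.ring_axioms M.R.ring_axioms)
      (auto simp: power_bimodule_def PiE_iff fun_eq_iff extensional_def M.lact_closed M.lact_add_left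
        M.lact_add_right M.lact_mult M.lact_one M.ract_closed M.ract_add_left M.ract_add_right
        M.ract_mult M.ract_one M.lact_ract)
qed

text \<open>The inclusion of the \<open>i\<close>-th coordinate. For \<open>i \<ge> N\<close> it
  gives the zero vector, so closure holds for every \<open>i\<close>.\<close>

definition single :: "('l, 'r, 'm, 'z) bimodule_scheme \<Rightarrow> nat \<Rightarrow> nat \<Rightarrow> 'm \<Rightarrow> nat \<Rightarrow> 'm"
  where "single M N i m = (\<lambda>j\<in>{..<N}. if j = i then m else \<zero>\<^bsub>M\<^esub>)"

lemma single_closed:
  assumes "abelian_group M" and "m \<in> carrier M"
  shows "single M N i m \<in> carrier (power_bimodule M N)"
proof -
  interpret abelian_group M by fact
  show ?thesis using assms(2) by (auto simp: single_def power_bimodule_def)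
qed

text \<open>The vector \<open>x\<close> is the sum of its coordinate vectors
  \<open>single M N i (x i)\<close>, and \<open>g\<close> is additive. Coordinates are switched on
  one at a time, so finite sums are formed in \<open>Q\<close> only.\<close>

lemma add_hom_power_eq_finsum:
  fixes M :: "('l, 'r, 'm, 'z) bimodule_scheme"
  assumes M: "bimodule L R M" and "abelian_group Q" and g: "g \<in> add_hom (power_bimodule M N) Q"
    and x: "x \<in> carrier (power_bimodule M N)"
  shows "g x = (\<Oplus>\<^bsub>Q\<^esub>i \<in> {..<N}. g (single M N i (x i)))"
proof -
  interpret M: bimodule L R M by fact
  interpret Q: abelian_group Q by fact
  let ?N = "power_bimodule M N"
  interpret N: bimodule L R ?N by (rule bimodule_power[OF M])
  have xi: "x i \<in> carrier M" if "i < N" for i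
    using x that by (auto simp: power_bimodule_def)
  \<comment> \<open>\<open>tr n\<close> keeps the first \<open>n\<close> coordinates of
    \<open>x\<close>: it runs from zero at \<open>n = 0\<close> to \<open>x\<close> at
    \<open>n = N\<close>, and each step adds one coordinate vector.\<close>
  define tr where "tr n = (\<lambda>i\<in>{..<N}. if i < n then x i else \<zero>\<^bsub>M\<^esub>)" for n
  have tr: "tr n \<in> carrier ?N" for n
    using xi by (auto simp: tr_def power_bimodule_def)
  have si: "g (single M N i (x i)) \<in> carrier Q" if "i < N" for i
    by (rule add_hom_closed[OF g single_closed[OF M.M.abelian_group_axioms xi[OF that]]])
  have "g (tr n) = (\<Oplus>\<^bsub>Q\<^esub>i \<in> {..<n}. g (single M N i (x i)))" if "n \<le> N" for n
    using that
  proof (induction n)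
    case 0
    have "tr 0 = \<zero>\<^bsub>?N\<^esub>"
      by (auto simp: tr_def power_bimodule_def)
    then show ?case
      using add_hom_zero[OF N.M.abelian_group_axioms Q.abelian_group_axioms g] by simp
  next
    case (Suc n)
    have "tr (Suc n) = single M N n (x n) \<oplus>\<^bsub>?N\<^esub> tr n"
      using Suc.prems xi by (auto simp: tr_def single_def power_bimodule_def fun_eq_iff less_Suc_eq)
    then have "g (tr (Suc n)) = g (single M N n (x n)) \<oplus>\<^bsub>Q\<^esub> g (tr n)"
      using single_closed[OF M.M.abelian_group_axioms xi] tr Suc.prems
      by (simp add: add_hom_add[OF g])
    also have "\<dots> = (\<Oplus>\<^bsub>Q\<^esub>i \<in> {..<Suc n}. g (single M N i (x i)))"
      using Suc si by (simp add: lessThan_Suc Q.finsum_insert Pi_def)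
    finally show ?case .
  qed
  moreover have "tr N = x"
    using x by (auto simp: tr_def power_bimodule_def fun_eq_iff PiE_iff extensional_def)
  ultimately show ?thesis by force
qed


section \<open>The tensor product as a bimodule\<close>

definition pure_tensor ::
    "('b, 'x) ring_scheme \<Rightarrow> ('l, 'b, 'm, 'z) bimodule_scheme \<Rightarrow>
     ('b, 'r, 'n, 'w) bimodule_scheme \<Rightarrow> 'm \<Rightarrow> 'n \<Rightarrow> ('m \<times> 'n \<Rightarrow>\<^sub>0 int) set"
  where "pure_tensor S M N m n = tensor_class S M N (frag_of (m, n))"

locale tensor_product = M: bimodule L S M + N: bimodule S R N
  for L :: "('l, 'x) ring_scheme" and S :: "('s, 'v) ring_scheme" and R :: "('r, 'y) ring_scheme"
    and M :: "('l, 's, 'm, 'z) bimodule_scheme" and N :: "('s, 'r, 'n, 'w) bimodule_scheme"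
begin

abbreviation "F \<equiv> tensor_gens M N"
abbreviation "T \<equiv> tensor S M N"
abbreviation "cls \<equiv> tensor_class S M N"
abbreviation "pure \<equiv> pure_tensor S M N"

lemma subgroup_rels: "subgroup (tensor_rels S M N) F"
  unfolding tensor_rels_def
  by (intro group.generate_is_subgroup group_free_Abelian_group
      tensor_relators_closed[OF M.bimodule_axioms N.bimodule_axioms])

lemma comm_group_gens: "comm_group F"
  by (rule abelian_free_Abelian_group)

lemma normal_rels: "tensor_rels S M N \<lhd> F"
  by (intro comm_group.normal_iff_subgroup[THEN iffD2] comm_group_gens subgroup_rels)

lemma abelian_group_tensor: "abelian_group T"
proof -
  interpret Q: comm_group "F Mod tensor_rels S M N"
    by (rule comm_group.abelian_FactGroup[OF comm_group_gens subgroup_rels])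
  have [simp]: "carrier T = carrier (F Mod tensor_rels S M N)"
    "\<zero>\<^bsub>T\<^esub> = \<one>\<^bsub>F Mod tensor_rels S M N\<^esub>" "s \<oplus>\<^bsub>T\<^esub> t = s \<otimes>\<^bsub>F Mod tensor_rels S M N\<^esub> t" for s t
    by (simp_all add: tensor_def Let_def)
  show ?thesis
    by (rule abelian_groupI)
      (simp_all add: Q.m_ac Q.l_inv_ex del: mult_FactGroup one_FactGroup)
qed

interpretation T: abelian_group T by (rule abelian_group_tensor)

section \<open>Classes of formal sums and elementary tensors\<close>

lemma carrier_tensor: "carrier T = cls ` carrier F"
  by (auto simp: tensor_def Let_def FactGroup_def RCOSETS_def tensor_class_def)

lemma cls_closed: "c \<in> carrier F \<Longrightarrow> cls c \<in> carrier T"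
  by (simp add: carrier_tensor)

lemma cls_add:
  assumes "c \<in> carrier F" "d \<in> carrier F"
  shows "cls (c + d) = cls c \<oplus>\<^bsub>T\<^esub> cls d"
  using normal.rcos_sum[OF normal_rels assms]
  by (simp add: tensor_def Let_def FactGroup_def tensor_class_def)

lemma gens_add: "c \<in> carrier F \<Longrightarrow> d \<in> carrier F \<Longrightarrow> c + d \<in> carrier F"
  using Poly_Mapping.keys_add[of c d] by (auto simp: carrier_free_Abelian_group_iff)

lemma gens_minus: "c \<in> carrier F \<Longrightarrow> - c \<in> carrier F"
  by (auto simp: carrier_free_Abelian_group_iff)

lemma gens_diff: "c \<in> carrier F \<Longrightarrow> d \<in> carrier F \<Longrightarrow> c - d \<in> carrier F"
  using gens_add[OF _ gens_minus, of c d] by simp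

lemma gens_of: "m \<in> carrier M \<Longrightarrow> n \<in> carrier N \<Longrightarrow> frag_of (m, n) \<in> carrier F"
  by (auto simp: carrier_free_Abelian_group_iff keys_frag_of)

lemma cls_eqI:
  assumes "c \<in> carrier F" and "d \<in> carrier F" and "c - d \<in> tensor_rels S M N"
  shows "cls c = cls d"
proof -
  have "c \<in> cls d"
    using assms(3) by (force simp: tensor_class_def r_coset_def)
  then show ?thesis
    unfolding tensor_class_def
    by (metis group.repr_independence[OF group_free_Abelian_group _ _ subgroup_rels] assms(2))
qed

lemma cls_zero: "cls 0 = \<zero>\<^bsub>T\<^esub>"
proof -
  have "(0 :: 'm \<times> 'n \<Rightarrow>\<^sub>0 int) \<in> carrier F" by (simp add: carrier_free_Abelian_group_iff)
  with cls_add[of 0 0] cls_closed[of 0] show ?thesis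
    by (metis T.add.l_cancel_one' add_0)
qed

lemma cls_minus: "c \<in> carrier F \<Longrightarrow> cls (- c) = \<ominus>\<^bsub>T\<^esub> cls c"
  using cls_add[OF gens_minus, of c c] cls_closed[of c] cls_closed[OF gens_minus, of c]
  by (intro T.minus_equality[symmetric]) (simp_all add: cls_zero del: carrier_free_Abelian_group_iff)

lemma pure_closed: "m \<in> carrier M \<Longrightarrow> n \<in> carrier N \<Longrightarrow> pure m n \<in> carrier T"
  unfolding pure_tensor_def by (intro cls_closed gens_of)

text \<open>Here and in the next two rules the representatives of the two sides differ by a single
  generating relator.\<close>

lemma pure_add_left:
  assumes "m \<in> carrier M" "m' \<in> carrier M" "n \<in> carrier N"
  shows "pure (m \<oplus>\<^bsub>M\<^esub> m') n = pure m n \<oplus>\<^bsub>T\<^esub> pure m' n"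
  unfolding pure_tensor_def cls_add[OF gens_of[OF assms(1,3)] gens_of[OF assms(2,3)], symmetric]
proof (rule cls_eqI)
  show "frag_of (m \<oplus>\<^bsub>M\<^esub> m', n) - (frag_of (m, n) + frag_of (m', n)) \<in> tensor_rels S M N"
    using generate.incl[OF tensor_relatorsI(1)[where M=M and N=N and S=S, OF assms]]
    by (simp add: tensor_rels_def diff_diff_eq)
qed (intro gens_of gens_add assms M.M.a_closed N.M.a_closed)+

lemma pure_add_right:
  assumes "m \<in> carrier M" "n \<in> carrier N" "n' \<in> carrier N"
  shows "pure m (n \<oplus>\<^bsub>N\<^esub> n') = pure m n \<oplus>\<^bsub>T\<^esub> pure m n'"
  unfolding pure_tensor_def cls_add[OF gens_of[OF assms(1,2)] gens_of[OF assms(1,3)], symmetric]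
proof (rule cls_eqI)
  show "frag_of (m, n \<oplus>\<^bsub>N\<^esub> n') - (frag_of (m, n) + frag_of (m, n')) \<in> tensor_rels S M N"
    using generate.incl[OF tensor_relatorsI(2)[where M=M and N=N and S=S, OF assms]]
    by (simp add: tensor_rels_def diff_diff_eq)
qed (intro gens_of gens_add assms M.M.a_closed N.M.a_closed)+

lemma pure_balanced:
  assumes "m \<in> carrier M" "s \<in> carrier S" "n \<in> carrier N"
  shows "pure (ract M m s) n = pure m (lact N s n)"
  unfolding pure_tensor_def
proof (rule cls_eqI)
  show "frag_of (ract M m s, n) - frag_of (m, lact N s n) \<in> tensor_rels S M N"
    using generate.incl[OF tensor_relatorsI(3)[where M=M and N=N and S=S, OF assms]]
    by (simp add: tensor_rels_def)
qed (use assms in \<open>auto intro!: gens_of M.ract_closed N.lact_closed\<close>)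

text \<open>Signs are absorbed into the left factor, which is why \<open>tensor_induct\<close> has
  no case for negatives.\<close>

lemma pure_minus:
  assumes "m \<in> carrier M" "n \<in> carrier N"
  shows "pure (\<ominus>\<^bsub>M\<^esub> m) n = \<ominus>\<^bsub>T\<^esub> pure m n"
proof -
  have "(\<lambda>m. pure m n) \<in> add_hom M T"
    using assms by (intro add_homI pure_closed pure_add_left)
  then interpret h: group_hom "add_monoid M" "add_monoid T" "\<lambda>m. pure m n"
    by (intro group_hom.intro group_hom_axioms.intro M.M.a_group T.a_group)
  show ?thesis using h.hom_inv[of m] assms by (simp add: a_inv_def)
qed

lemma tensor_induct [consumes 1, case_names pure add]:
  assumes t: "t \<in> carrier T"
    and pure: "\<And>m n. m \<in> carrier M \<Longrightarrow> n \<in> carrier N \<Longrightarrow> Q (pure m n)"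
    and add: "\<And>s t. s \<in> carrier T \<Longrightarrow> t \<in> carrier T \<Longrightarrow> Q s \<Longrightarrow> Q t \<Longrightarrow> Q (s \<oplus>\<^bsub>T\<^esub> t)"
  shows "Q t"
proof -
  obtain c where c: "c \<in> carrier F" "t = cls c"
    using t by (auto simp: carrier_tensor)
  \<comment> \<open>Zero is itself a pure tensor, so the empty formal sum falls under the case
    \<open>pure\<close>.\<close>
  have pure_zero: "pure \<zero>\<^bsub>M\<^esub> \<zero>\<^bsub>N\<^esub> = \<zero>\<^bsub>T\<^esub>"
    using pure_minus[of "\<zero>\<^bsub>M\<^esub>" "\<zero>\<^bsub>N\<^esub>"] pure_add_left[of "\<zero>\<^bsub>M\<^esub>" "\<zero>\<^bsub>M\<^esub>" "\<zero>\<^bsub>N\<^esub>"]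
      pure_closed[of "\<zero>\<^bsub>M\<^esub>" "\<zero>\<^bsub>N\<^esub>"]
    by (simp add: T.r_neg)
  have minus_zero: "\<ominus>\<^bsub>T\<^esub> \<zero>\<^bsub>T\<^esub> = \<zero>\<^bsub>T\<^esub>"
    by (rule T.minus_equality) simp_all
  \<comment> \<open>\<open>frag_induction\<close> builds formal sums by differences, so the claim is
    strengthened to a class and its negative. Membership in \<open>F\<close> travels along because
    the induction does not supply it for the two parts of a difference.\<close>
  have "c \<in> carrier F \<and> Q (cls c) \<and> Q (\<ominus>\<^bsub>T\<^esub> cls c)"
    using c(1)[unfolded carrier_free_Abelian_group_iff]
  proof (induction c rule: frag_induction)
    case zero
    then show ?case
      using pure[of "\<zero>\<^bsub>M\<^esub>" "\<zero>\<^bsub>N\<^esub>"] by (simp add: cls_zero pure_zero minus_zero)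
  next
    case (one k)
    then show ?case
      using pure pure_minus gens_of by (cases k) (auto simp flip: pure_tensor_def, metis M.M.a_inv_closed)
  next
    case (diff a b)
    then have eq: "cls (a - b) = cls a \<oplus>\<^bsub>T\<^esub> \<ominus>\<^bsub>T\<^esub> cls b"
      using cls_add[OF _ gens_minus, of a b] by (simp add: cls_minus)
    then show ?case
      using diff add gens_diff by (simp add: T.minus_add cls_closed)
  qed
  then show ?thesis using c by simp
qed

text \<open>Justifies computing with \<open>t^1\<close> and \<open>t^2\<close>, summation
  suppressed: when both sides are additive in the tensor, pure tensors suffice.\<close>

lemma add_hom_tensor_eqI:
  assumes "t \<in> carrier T" and h: "h \<in> add_hom T G" and k: "k \<in> add_hom T G"
    and eq: "\<And>m n. m \<in> carrier M \<Longrightarrow> n \<in> carrier N \<Longrightarrow> h (pure m n) = k (pure m n)"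
  shows "h t = k t"
  using assms(1) by (induction rule: tensor_induct) (simp_all add: eq add_hom_add[OF h] add_hom_add[OF k])

section \<open>The two actions on the tensor product\<close>

lemma frag_extend_closed:
  assumes "c \<in> carrier F" and "\<And>m n. m \<in> carrier M \<Longrightarrow> n \<in> carrier N \<Longrightarrow> f m \<in> carrier M \<and> g n \<in> carrier N"
  shows "frag_extend (\<lambda>(m, n). frag_of (f m, g n)) c \<in> carrier F"
proof -
  have "Poly_Mapping.keys (frag_extend (\<lambda>(m, n). frag_of (f m, g n)) c) \<subseteq> (\<Union>k \<in> Poly_Mapping.keys c.
      Poly_Mapping.keys ((\<lambda>(m, n). frag_of (f m, g n)) k :: _ \<Rightarrow>\<^sub>0 int))"
    by (rule keys_frag_extend)
  also have "\<dots> \<subseteq> carrier M \<times> carrier N"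
  proof (intro UN_least)
    fix k assume "k \<in> Poly_Mapping.keys c"
    then have "k \<in> carrier M \<times> carrier N"
      using assms(1) unfolding carrier_free_Abelian_group_iff by blast
    then show "Poly_Mapping.keys ((\<lambda>(m, n). frag_of (f m, g n)) k :: _ \<Rightarrow>\<^sub>0 int) \<subseteq> carrier M \<times> carrier N"
      using assms(2) by (auto simp: keys_frag_of)
  qed
  finally show ?thesis by (simp add: carrier_free_Abelian_group_iff)
qed

text \<open>\<open>lact_tensor_class\<close> replaces the union over representatives by
  \<open>frag_extend\<close> of one of them, and \<open>frag_extend\<close> is additive. The right
  action is handled alike.\<close>

lemma lact_tensor_add_hom:
  assumes a: "a \<in> carrier L"
  shows "lact T a \<in> add_hom T T"
proof -
  note cl = lact_tensor_class[OF M.bimodule_axioms N.bimodule_axioms a]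
  have ext: "frag_extend (\<lambda>(m, n). frag_of (lact M a m, n)) c \<in> carrier F" if "c \<in> carrier F" for c
    using that M.lact_closed[OF a] by (intro frag_extend_closed) auto
  show ?thesis
  proof (rule add_homI)
    fix t assume "t \<in> carrier T"
    then obtain c where c: "c \<in> carrier F" "t = cls c"
      unfolding carrier_tensor by blast
    show "lact T a t \<in> carrier T"
      unfolding c(2) cl[OF c(1)] by (intro cls_closed ext c(1))
    fix u assume "u \<in> carrier T"
    then obtain d where d: "d \<in> carrier F" "u = cls d"
      unfolding carrier_tensor by blast
    show "lact T a (t \<oplus>\<^bsub>T\<^esub> u) = lact T a t \<oplus>\<^bsub>T\<^esub> lact T a u"
      unfolding c(2) d(2) cls_add[OF c(1) d(1), symmetric] cl[OF c(1)] cl[OF d(1)]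
        cl[OF gens_add[OF c(1) d(1)]] frag_extend_add by (intro cls_add ext c(1) d(1))
  qed
qed

lemma ract_tensor_add_hom:
  assumes a: "a \<in> carrier R"
  shows "(\<lambda>t. ract T t a) \<in> add_hom T T"
proof -
  note cl = ract_tensor_class[OF M.bimodule_axioms N.bimodule_axioms a]
  have ext: "frag_extend (\<lambda>(m, n). frag_of (m, ract N n a)) c \<in> carrier F" if "c \<in> carrier F" for c
    using that N.ract_closed[OF _ a] by (intro frag_extend_closed) auto
  show ?thesis
  proof (rule add_homI)
    fix t assume "t \<in> carrier T"
    then obtain c where c: "c \<in> carrier F" "t = cls c"
      unfolding carrier_tensor by blast
    show "ract T t a \<in> carrier T"
      unfolding c(2) cl[OF c(1)] by (intro cls_closed ext c(1))
    fix u assume "u \<in> carrier T"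
    then obtain d where d: "d \<in> carrier F" "u = cls d"
      unfolding carrier_tensor by blast
    show "ract T (t \<oplus>\<^bsub>T\<^esub> u) a = ract T t a \<oplus>\<^bsub>T\<^esub> ract T u a"
      unfolding c(2) d(2) cls_add[OF c(1) d(1), symmetric] cl[OF c(1)] cl[OF d(1)]
        cl[OF gens_add[OF c(1) d(1)]] frag_extend_add by (intro cls_add ext c(1) d(1))
  qed
qed

lemma lact_pure:
  "a \<in> carrier L \<Longrightarrow> m \<in> carrier M \<Longrightarrow> n \<in> carrier N \<Longrightarrow> lact T a (pure m n) = pure (lact M a m) n"
  by (simp add: pure_tensor_def lact_tensor_class[OF M.bimodule_axioms N.bimodule_axioms])

lemma ract_pure:
  "a \<in> carrier R \<Longrightarrow> m \<in> carrier M \<Longrightarrow> n \<in> carrier N \<Longrightarrow> ract T (pure m n) a = pure m (ract N n a)"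
  by (simp add: pure_tensor_def ract_tensor_class[OF M.bimodule_axioms N.bimodule_axioms])

text \<open>Each law holds on pure tensors by the laws of the two factors and passes to sums because
  both actions are additive.\<close>

lemma bimodule_tensor: "bimodule L R T"
proof -
  note [simp] = lact_pure ract_pure pure_closed M.lact_closed N.ract_closed
  have lact: "lact T a t \<in> carrier T" if "a \<in> carrier L" "t \<in> carrier T" for a t
    using lact_tensor_add_hom[OF that(1)] that(2) by (rule add_hom_closed)
  have ract: "ract T t a \<in> carrier T" if "a \<in> carrier R" "t \<in> carrier T" for a t
    using ract_tensor_add_hom[OF that(1)] that(2) by (rule add_hom_closed)
  have lact_add: "lact T a (s \<oplus>\<^bsub>T\<^esub> t) = lact T a s \<oplus>\<^bsub>T\<^esub> lact T a t"
    if "a \<in> carrier L" "s \<in> carrier T" "t \<in> carrier T" for a s t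
    using lact_tensor_add_hom[OF that(1)] that(2,3) by (rule add_hom_add)
  have ract_add: "ract T (s \<oplus>\<^bsub>T\<^esub> t) a = ract T s a \<oplus>\<^bsub>T\<^esub> ract T t a"
    if "a \<in> carrier R" "s \<in> carrier T" "t \<in> carrier T" for a s t
    using ract_tensor_add_hom[OF that(1)] that(2,3) by (rule add_hom_add)
  show ?thesis
  proof (intro bimodule.intro bimodule_axioms.intro M.L.ring_axioms N.R.ring_axioms
      abelian_group_tensor)
    fix a b t assume a: "a \<in> carrier L" and b: "b \<in> carrier L" and t: "t \<in> carrier T"
    show "lact T (a \<oplus>\<^bsub>L\<^esub> b) t = lact T a t \<oplus>\<^bsub>T\<^esub> lact T b t"
      using t by (induction rule: tensor_induct)
        (simp_all add: a b M.lact_add_left pure_add_left lact lact_add T.a_ac)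
    show "lact T (a \<otimes>\<^bsub>L\<^esub> b) t = lact T a (lact T b t)"
      using t by (induction rule: tensor_induct) (simp_all add: a b M.lact_mult lact lact_add)
  next
    fix t r s assume t: "t \<in> carrier T" and r: "r \<in> carrier R" and s: "s \<in> carrier R"
    show "ract T t (r \<oplus>\<^bsub>R\<^esub> s) = ract T t r \<oplus>\<^bsub>T\<^esub> ract T t s"
      using t by (induction rule: tensor_induct)
        (simp_all add: r s N.ract_add_right pure_add_right ract ract_add T.a_ac)
    show "ract T t (r \<otimes>\<^bsub>R\<^esub> s) = ract T (ract T t r) s"
      using t by (induction rule: tensor_induct) (simp_all add: r s N.ract_mult ract ract_add)
  next
    fix a t s assume a: "a \<in> carrier L" and t: "t \<in> carrier T" and s: "s \<in> carrier R"
    show "ract T (lact T a t) s = lact T a (ract T t s)"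
      using t by (induction rule: tensor_induct) (simp_all add: a s lact ract lact_add ract_add)
  next
    fix t assume t: "t \<in> carrier T"
    show "lact T \<one>\<^bsub>L\<^esub> t = t"
      using t by (induction rule: tensor_induct) (simp_all add: M.lact_one lact_add)
    show "ract T t \<one>\<^bsub>R\<^esub> = t"
      using t by (induction rule: tensor_induct) (simp_all add: N.ract_one ract_add)
  qed (simp_all add: lact ract lact_add ract_add)
qed

text \<open>The universal property of the tensor product. Additivity together with the value on pure
  tensors is all that is used about the lift from here on.\<close>

lemma tensor_lift:
  assumes P: "abelian_group P"
    and cl: "\<And>m n. m \<in> carrier M \<Longrightarrow> n \<in> carrier N \<Longrightarrow> \<phi> m n \<in> carrier P"
    and add_l: "\<And>m m' n. m \<in> carrier M \<Longrightarrow> m' \<in> carrier M \<Longrightarrow> n \<in> carrier N \<Longrightarrow>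
      \<phi> (m \<oplus>\<^bsub>M\<^esub> m') n = \<phi> m n \<oplus>\<^bsub>P\<^esub> \<phi> m' n"
    and add_r: "\<And>m n n'. m \<in> carrier M \<Longrightarrow> n \<in> carrier N \<Longrightarrow> n' \<in> carrier N \<Longrightarrow>
      \<phi> m (n \<oplus>\<^bsub>N\<^esub> n') = \<phi> m n \<oplus>\<^bsub>P\<^esub> \<phi> m n'"
    and balanced: "\<And>m s n. m \<in> carrier M \<Longrightarrow> s \<in> carrier S \<Longrightarrow> n \<in> carrier N \<Longrightarrow>
      \<phi> (ract M m s) n = \<phi> m (lact N s n)"
  shows "tensor_lift P \<phi> \<in> add_hom T P"
    and "m \<in> carrier M \<Longrightarrow> n \<in> carrier N \<Longrightarrow> tensor_lift P \<phi> (pure m n) = \<phi> m n"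
proof -
  interpret P: abelian_group P by fact
  have lift: "tensor_lift P \<phi> (cls c) = frag_eval P \<phi> c" if "c \<in> carrier F" for c
    by (rule tensor_lift_class[OF P M.bimodule_axioms N.bimodule_axioms cl add_l add_r balanced that])
  have ev: "frag_eval P \<phi> \<in> hom F (add_monoid P)"
    using P cl by (rule frag_eval_hom)
  show "tensor_lift P \<phi> \<in> add_hom T P"
  proof (rule add_homI)
    fix t assume "t \<in> carrier T"
    then obtain c where c: "c \<in> carrier F" "t = cls c"
      unfolding carrier_tensor by blast
    show "tensor_lift P \<phi> t \<in> carrier P"
      using hom_in_carrier[OF ev c(1)] by (simp add: c(2) lift[OF c(1)])
    fix u assume "u \<in> carrier T"
    then obtain d where d: "d \<in> carrier F" "u = cls d"
      unfolding carrier_tensor by blast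
    show "tensor_lift P \<phi> (t \<oplus>\<^bsub>T\<^esub> u) = tensor_lift P \<phi> t \<oplus>\<^bsub>P\<^esub> tensor_lift P \<phi> u"
      using hom_mult[OF ev c(1) d(1)]
      unfolding c(2) d(2) cls_add[OF c(1) d(1), symmetric] lift[OF c(1)] lift[OF d(1)]
        lift[OF gens_add[OF c(1) d(1)]] by simp
  qed
  show "tensor_lift P \<phi> (pure m n) = \<phi> m n" if "m \<in> carrier M" "n \<in> carrier N"
    using that cl by (simp add: pure_tensor_def lift frag_eval_def keys_frag_of)
qed

end


section \<open>Depth two quasibases\<close>

locale ring_extension = A?: ring A for A :: "('a, 'x) ring_scheme" (structure) +
  fixes B :: "'a set"
  assumes subring: "subring B A"
begin

abbreviation "AB \<equiv> A\<lparr>carrier := B\<rparr>"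
abbreviation "RA \<equiv> regular_bimodule A"
abbreviation "Q \<equiv> tensor_square A B"
abbreviation "pure \<equiv> pure_tensor AB RA RA"

lemma B_subset: "b \<in> B \<Longrightarrow> b \<in> carrier A"
  using subringE(1)[OF subring] by blast

lemma bimodule_RA: "bimodule A A RA"
  by (rule bimodule_regular[OF ring_axioms])

lemma restrict_left: "bimodule A A M \<Longrightarrow> bimodule AB A M"
  using bimodule.restrict_scalars[OF _ subring carrier_is_subring] by fastforce

lemma restrict_right: "bimodule A A M \<Longrightarrow> bimodule A AB M"
  using bimodule.restrict_scalars[OF _ carrier_is_subring subring] by fastforce

interpretation sq: tensor_product A AB A RA RA
  by (intro tensor_product.intro restrict_left restrict_right bimodule_RA)

lemma bimodule_square: "bimodule A A Q"
  unfolding tensor_square_def by (rule sq.bimodule_tensor)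

interpretation Q: bimodule A A Q by (rule bimodule_square)

lemma pure_closed: "x \<in> carrier A \<Longrightarrow> y \<in> carrier A \<Longrightarrow> pure x y \<in> carrier Q"
  using sq.pure_closed[folded tensor_square_def] by simp

lemma pure_add_left:
  "x \<in> carrier A \<Longrightarrow> x' \<in> carrier A \<Longrightarrow> y \<in> carrier A \<Longrightarrow> pure (x \<oplus> x') y = pure x y \<oplus>\<^bsub>Q\<^esub> pure x' y"
  using sq.pure_add_left[folded tensor_square_def] by simp

lemma pure_add_right:
  "x \<in> carrier A \<Longrightarrow> y \<in> carrier A \<Longrightarrow> y' \<in> carrier A \<Longrightarrow> pure x (y \<oplus> y') = pure x y \<oplus>\<^bsub>Q\<^esub> pure x y'"
  using sq.pure_add_right[folded tensor_square_def] by simp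

lemma pure_balanced:
  "x \<in> carrier A \<Longrightarrow> b \<in> B \<Longrightarrow> y \<in> carrier A \<Longrightarrow> pure (x \<otimes> b) y = pure x (b \<otimes> y)"
  using sq.pure_balanced by simp

lemma lact_pure:
  "a \<in> carrier A \<Longrightarrow> x \<in> carrier A \<Longrightarrow> y \<in> carrier A \<Longrightarrow> lact Q a (pure x y) = pure (a \<otimes> x) y"
  using sq.lact_pure[folded tensor_square_def] by simp

lemma ract_pure:
  "a \<in> carrier A \<Longrightarrow> x \<in> carrier A \<Longrightarrow> y \<in> carrier A \<Longrightarrow> ract Q (pure x y) a = pure x (y \<otimes> a)"
  using sq.ract_pure[folded tensor_square_def] by simp

lemma add_hom_square_eqI:
  assumes "t \<in> carrier Q" "h \<in> add_hom Q G" "k \<in> add_hom Q G"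
    and "\<And>x y. x \<in> carrier A \<Longrightarrow> y \<in> carrier A \<Longrightarrow> h (pure x y) = k (pure x y)"
  shows "h t = k t"
  by (rule sq.add_hom_tensor_eqI[folded tensor_square_def, OF assms(1-3)]) (simp add: assms(4))

lemma T_setD:
  assumes "t \<in> T_set A B"
  shows "t \<in> carrier Q" and "b \<in> B \<Longrightarrow> lact Q b t = ract Q t b"
  using assms by (auto simp: T_set_def centralized_def)

section \<open>Quasibases from the unit vectors of the power\<close>

lemma lact_single:
  "a \<in> carrier A \<Longrightarrow> x \<in> carrier A \<Longrightarrow> lact (power_bimodule RA N) a (single RA N i x) = single RA N i (a \<otimes> x)"
  by (auto simp: single_def power_bimodule_def)

lemma ract_single:
  "a \<in> carrier A \<Longrightarrow> x \<in> carrier A \<Longrightarrow> ract (power_bimodule RA N) (single RA N i x) a = single RA N i (x \<otimes> a)"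
  by (auto simp: single_def power_bimodule_def)

lemma single_RA_closed: "x \<in> carrier A \<Longrightarrow> single RA N i x \<in> carrier (power_bimodule RA N)"
  using single_closed[OF bimodule.axioms(3)[OF bimodule_RA]] by simp

text \<open>A unit vector \<open>e\<close> satisfies \<open>b e = e b\<close>, its entries being
  \<open>\<one>\<close> and zero, and a \<open>B\<close>-\<open>B\<close>-bilinear map carries this
  relation into the tensor square.\<close>

lemma single_one_image_T_set:
  assumes g: "g \<in> bimod_hom AB AB (power_bimodule RA N) Q"
  shows "g (single RA N i \<one>) \<in> T_set A B"
proof -
  have "lact Q b (g (single RA N i \<one>)) = ract Q (g (single RA N i \<one>)) b" if b: "b \<in> B" for b
    using bimod_homD(4)[OF g, of b "single RA N i \<one>"] bimod_homD(5)[OF g, of "single RA N i \<one>" b]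
      b B_subset[OF b] by (simp add: single_RA_closed lact_single ract_single)
  then show ?thesis
    using bimod_homD(1)[OF g single_RA_closed] by (simp add: T_set_def centralized_def)
qed

lemma bimod_hom_restrict_BB:
  "f \<in> bimod_hom AB A M N \<Longrightarrow> f \<in> bimod_hom AB AB M N"
  "f \<in> bimod_hom A AB M N \<Longrightarrow> f \<in> bimod_hom AB AB M N"
  by (auto simp: bimod_hom_def B_subset)

lemma power_component:
  assumes "i < N"
  shows "(\<lambda>x. x i) \<in> add_hom (power_bimodule RA N) RA"
    and "lact (power_bimodule RA N) a x i = a \<otimes> x i"
    and "ract (power_bimodule RA N) x a i = x i \<otimes> a"
proof -
  show "(\<lambda>x. x i) \<in> add_hom (power_bimodule RA N) RA"
    using assms by (intro add_homI) (auto simp: power_bimodule_def)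
qed (use assms in \<open>simp_all add: power_bimodule_def\<close>)

text \<open>With the split injection \<open>f\<close> and its retraction \<open>g\<close>,
  \<open>t i\<close> is the image under \<open>g\<close> of the \<open>i\<close>-th unit vector and
  \<open>\<beta> i x\<close> is the \<open>i\<close>-th coordinate of
  \<open>f (pure x \<one>)\<close>.\<close>

lemma right_quasibase:
  assumes "iso_to_direct_summand AB A Q (power_bimodule RA N)"
  obtains t \<beta> where "\<And>i. i < N \<Longrightarrow> t i \<in> T_set A B" and "\<And>i. i < N \<Longrightarrow> \<beta> i \<in> Hom_BB A B RA"
    and "\<And>x. x \<in> carrier A \<Longrightarrow> pure x \<one> = (\<Oplus>\<^bsub>Q\<^esub>i \<in> {..<N}. ract Q (t i) (\<beta> i x))"
proof -
  let ?N = "power_bimodule RA N"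
  have "bimodule AB A Q" "bimodule AB A ?N"
    by (intro restrict_left bimodule_square bimodule_power bimodule_RA)+
  then obtain f g where f: "f \<in> bimod_hom AB A Q ?N" and g: "g \<in> bimod_hom AB A ?N Q"
    and gf: "\<And>m. m \<in> carrier Q \<Longrightarrow> g (f m) = m"
    using iso_to_direct_summand_retract[OF _ _ assms] by metis
  note fD = bimod_homD[OF f] and gD = bimod_homD[OF g]
  define \<beta> where "\<beta> i = (\<lambda>x \<in> carrier A. f (pure x \<one>) i)" for i
  have comp: "f (pure x \<one>) i \<in> carrier A" if "x \<in> carrier A" "i < N" for x i
    using add_hom_closed[OF power_component(1)[OF that(2)] fD(1)[OF pure_closed[OF that(1) one_closed]]]
    by simp
  show thesis
  proof
    show "g (single RA N i \<one>) \<in> T_set A B" for i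
      using g by (intro single_one_image_T_set bimod_hom_restrict_BB(1))
    show "\<beta> i \<in> Hom_BB A B RA" if i: "i < N" for i
      unfolding Hom_BB_def
    proof (rule bimod_homI, goal_cases)
      case (3 x y)
      then show ?case
        using add_hom_add[OF power_component(1)[OF i]]
        by (simp add: \<beta>_def pure_add_left fD pure_closed)
    next
      case (4 b x)
      then have "pure (b \<otimes> x) \<one> = lact Q b (pure x \<one>)"
        by (simp add: lact_pure B_subset)
      then show ?case
        using 4 by (simp add: \<beta>_def fD pure_closed B_subset power_component[OF i])
    next
      \<comment> \<open>Balancing moves \<open>b\<close> across the tensor sign:
        \<open>xb \<otimes> 1 = x \<otimes> b = (x \<otimes> 1) b\<close>.\<close>
      case (5 x b)
      then have "pure (x \<otimes> b) \<one> = ract Q (pure x \<one>) b"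
        by (simp add: ract_pure pure_balanced B_subset)
      then show ?case
        using 5 by (simp add: \<beta>_def fD pure_closed B_subset power_component[OF i])
    qed (use comp i in \<open>auto simp: \<beta>_def\<close>)
    show "pure x \<one> = (\<Oplus>\<^bsub>Q\<^esub>i \<in> {..<N}. ract Q (g (single RA N i \<one>)) (\<beta> i x))"
      if x: "x \<in> carrier A" for x
    proof -
      have "pure x \<one> = (\<Oplus>\<^bsub>Q\<^esub>i \<in> {..<N}. g (single RA N i (f (pure x \<one>) i)))"
        using add_hom_power_eq_finsum[OF bimodule_RA Q.M.abelian_group_axioms bimod_hom_add_hom[OF g]
            fD(1)[OF pure_closed[OF x one_closed]]] gf[OF pure_closed[OF x one_closed]] by simp
      \<comment> \<open>The retraction is right \<open>A\<close>-linear and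
        \<open>single RA N i a\<close> is the unit vector times \<open>a\<close>, so the coordinate
        leaves \<open>g\<close> as a scalar on the right.\<close>
      also have "\<dots> = (\<Oplus>\<^bsub>Q\<^esub>i \<in> {..<N}. ract Q (g (single RA N i \<one>)) (\<beta> i x))"
      proof (rule Q.M.finsum_cong')
        fix i assume "i \<in> {..<N}"
        then show "g (single RA N i (f (pure x \<one>) i)) = ract Q (g (single RA N i \<one>)) (\<beta> i x)"
          using gD(5)[OF single_RA_closed[OF one_closed] comp[OF x]] comp[OF x] x
          by (simp add: ract_single \<beta>_def)
      qed (use comp x in \<open>auto simp: \<beta>_def intro!: Q.ract_closed gD(1) single_RA_closed\<close>)
      finally show ?thesis .
    qed
  qed
qed

text \<open>The mirror image, from the \<open>A\<close>-\<open>B\<close>-splitting: now left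
  \<open>A\<close>-linearity of \<open>g\<close> lets the coordinates of
  \<open>f (pure \<one> y)\<close> out on the left.\<close>

lemma left_quasibase:
  assumes "iso_to_direct_summand A AB Q (power_bimodule RA N)"
  obtains u \<gamma> where "\<And>i. i < N \<Longrightarrow> u i \<in> T_set A B" and "\<And>i. i < N \<Longrightarrow> \<gamma> i \<in> Hom_BB A B RA"
    and "\<And>y. y \<in> carrier A \<Longrightarrow> pure \<one> y = (\<Oplus>\<^bsub>Q\<^esub>i \<in> {..<N}. lact Q (\<gamma> i y) (u i))"
proof -
  let ?N = "power_bimodule RA N"
  have "bimodule A AB Q" "bimodule A AB ?N"
    by (intro restrict_right bimodule_square bimodule_power bimodule_RA)+
  then obtain f g where f: "f \<in> bimod_hom A AB Q ?N" and g: "g \<in> bimod_hom A AB ?N Q"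
    and gf: "\<And>m. m \<in> carrier Q \<Longrightarrow> g (f m) = m"
    using iso_to_direct_summand_retract[OF _ _ assms] by metis
  note fD = bimod_homD[OF f] and gD = bimod_homD[OF g]
  define \<gamma> where "\<gamma> i = (\<lambda>y \<in> carrier A. f (pure \<one> y) i)" for i
  have comp: "f (pure \<one> y) i \<in> carrier A" if "y \<in> carrier A" "i < N" for y i
    using add_hom_closed[OF power_component(1)[OF that(2)] fD(1)[OF pure_closed[OF one_closed that(1)]]]
    by simp
  show thesis
  proof
    show "g (single RA N i \<one>) \<in> T_set A B" for i
      using g by (intro single_one_image_T_set bimod_hom_restrict_BB(2))
    show "\<gamma> i \<in> Hom_BB A B RA" if i: "i < N" for i
      unfolding Hom_BB_def
    proof (rule bimod_homI, goal_cases)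
      case (3 x y)
      then show ?case
        using add_hom_add[OF power_component(1)[OF i]]
        by (simp add: \<gamma>_def pure_add_right fD pure_closed)
    next
      \<comment> \<open>Balancing gives
        \<open>1 \<otimes> by = b \<otimes> y = b (1 \<otimes> y)\<close>.\<close>
      case (4 b y)
      then have "pure \<one> (b \<otimes> y) = lact Q b (pure \<one> y)"
        using pure_balanced[of \<one> b y] by (simp add: lact_pure B_subset)
      then show ?case
        using 4 by (simp add: \<gamma>_def fD pure_closed B_subset power_component[OF i])
    next
      case (5 y b)
      then have "pure \<one> (y \<otimes> b) = ract Q (pure \<one> y) b"
        by (simp add: ract_pure B_subset)
      then show ?case
        using 5 by (simp add: \<gamma>_def fD pure_closed B_subset power_component[OF i])
    qed (use comp i in \<open>auto simp: \<gamma>_def\<close>)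
    show "pure \<one> y = (\<Oplus>\<^bsub>Q\<^esub>i \<in> {..<N}. lact Q (\<gamma> i y) (g (single RA N i \<one>)))"
      if y: "y \<in> carrier A" for y
    proof -
      have "pure \<one> y = (\<Oplus>\<^bsub>Q\<^esub>i \<in> {..<N}. g (single RA N i (f (pure \<one> y) i)))"
        using add_hom_power_eq_finsum[OF bimodule_RA Q.M.abelian_group_axioms bimod_hom_add_hom[OF g]
            fD(1)[OF pure_closed[OF one_closed y]]] gf[OF pure_closed[OF one_closed y]] by simp
      also have "\<dots> = (\<Oplus>\<^bsub>Q\<^esub>i \<in> {..<N}. lact Q (\<gamma> i y) (g (single RA N i \<one>)))"
      proof (rule Q.M.finsum_cong')
        fix i assume "i \<in> {..<N}"
        then show "g (single RA N i (f (pure \<one> y) i)) = lact Q (\<gamma> i y) (g (single RA N i \<one>))"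
          using gD(4)[OF comp[OF y] single_RA_closed[OF one_closed]] comp[OF y] y
          by (simp add: lact_single \<gamma>_def)
      qed (use comp y in \<open>auto simp: \<gamma>_def intro!: Q.lact_closed gD(1) single_RA_closed\<close>)
      finally show ?thesis .
    qed
  qed
qed


section \<open>The pairings\<close>

lemma Hom_BB_D:
  assumes "\<alpha> \<in> Hom_BB A B P"
  shows "x \<in> carrier A \<Longrightarrow> \<alpha> x \<in> carrier P"
    and "x \<notin> carrier A \<Longrightarrow> \<alpha> x = undefined"
    and "x \<in> carrier A \<Longrightarrow> y \<in> carrier A \<Longrightarrow> \<alpha> (x \<oplus> y) = \<alpha> x \<oplus>\<^bsub>P\<^esub> \<alpha> y"
    and "b \<in> B \<Longrightarrow> x \<in> carrier A \<Longrightarrow> \<alpha> (b \<otimes> x) = lact P b (\<alpha> x)"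
    and "x \<in> carrier A \<Longrightarrow> b \<in> B \<Longrightarrow> \<alpha> (x \<otimes> b) = ract P (\<alpha> x) b"
  using bimod_homD[OF assms[unfolded Hom_BB_def]] by simp_all

lemma Hom_BB_I:
  assumes "\<And>x. x \<in> carrier A \<Longrightarrow> \<alpha> x \<in> carrier P"
    and "\<And>x. x \<notin> carrier A \<Longrightarrow> \<alpha> x = undefined"
    and "\<And>x y. x \<in> carrier A \<Longrightarrow> y \<in> carrier A \<Longrightarrow> \<alpha> (x \<oplus> y) = \<alpha> x \<oplus>\<^bsub>P\<^esub> \<alpha> y"
    and "\<And>b x. b \<in> B \<Longrightarrow> x \<in> carrier A \<Longrightarrow> \<alpha> (b \<otimes> x) = lact P b (\<alpha> x)"
    and "\<And>x b. x \<in> carrier A \<Longrightarrow> b \<in> B \<Longrightarrow> \<alpha> (x \<otimes> b) = ract P (\<alpha> x) b"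
  shows "\<alpha> \<in> Hom_BB A B P"
  unfolding Hom_BB_def using assms by (intro bimod_homI) simp_all

lemma Hom_BB_eqI:
  assumes "\<alpha> \<in> Hom_BB A B P" "\<beta> \<in> Hom_BB A B P" "\<And>x. x \<in> carrier A \<Longrightarrow> \<alpha> x = \<beta> x"
  shows "\<alpha> = \<beta>"
  using Hom_BB_D(2)[OF assms(1)] Hom_BB_D(2)[OF assms(2)] assms(3) by (metis ext)

context
  fixes P :: "('a, 'a, 'p, 'z) bimodule_scheme"
  assumes P: "bimodule A A P"
begin

interpretation P: bimodule A A P by (rule P)

text \<open>The form \<open>\<alpha>(x) y\<close> is balanced because \<open>\<alpha>\<close> is
  right \<open>B\<close>-linear: \<open>\<alpha>(xb) y = \<alpha>(x) (by)\<close>.\<close>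

lemma angle_pairing:
  assumes \<alpha>: "\<alpha> \<in> Hom_BB A B P"
  shows "angle_pairing P \<alpha> \<in> add_hom Q P"
    and "x \<in> carrier A \<Longrightarrow> y \<in> carrier A \<Longrightarrow> angle_pairing P \<alpha> (pure x y) = ract P (\<alpha> x) y"
proof -
  note lift = sq.tensor_lift[folded tensor_square_def, OF P.M.abelian_group_axioms,
      of "\<lambda>x y. ract P (\<alpha> x) y", simplified]
  note \<alpha>D = Hom_BB_D[OF \<alpha>]
  show "angle_pairing P \<alpha> \<in> add_hom Q P"
    unfolding angle_pairing_def
    by (rule lift(1)) (simp_all add: \<alpha>D P.ract_closed P.ract_add_left P.ract_add_right P.ract_mult B_subset)
  show "angle_pairing P \<alpha> (pure x y) = ract P (\<alpha> x) y" if "x \<in> carrier A" "y \<in> carrier A"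
    unfolding angle_pairing_def using that
    by (intro lift(2)) (simp_all add: \<alpha>D P.ract_closed P.ract_add_left P.ract_add_right P.ract_mult B_subset)
qed

text \<open>Balancedness now comes from left \<open>B\<close>-linearity:
  \<open>(xb) \<beta>(y) = x \<beta>(by)\<close>.\<close>

lemma square_pairing:
  assumes \<beta>: "\<beta> \<in> Hom_BB A B P"
  shows "(\<lambda>t. square_pairing P t \<beta>) \<in> add_hom Q P"
    and "x \<in> carrier A \<Longrightarrow> y \<in> carrier A \<Longrightarrow> square_pairing P (pure x y) \<beta> = lact P x (\<beta> y)"
proof -
  note lift = sq.tensor_lift[folded tensor_square_def, OF P.M.abelian_group_axioms,
      of "\<lambda>x y. lact P x (\<beta> y)", simplified]
  note \<beta>D = Hom_BB_D[OF \<beta>]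
  show "(\<lambda>t. square_pairing P t \<beta>) \<in> add_hom Q P"
    unfolding square_pairing_def
    by (rule lift(1)) (simp_all add: \<beta>D P.lact_closed P.lact_add_left P.lact_add_right P.lact_mult B_subset)
  show "square_pairing P (pure x y) \<beta> = lact P x (\<beta> y)" if "x \<in> carrier A" "y \<in> carrier A"
    unfolding square_pairing_def using that
    by (intro lift(2)) (simp_all add: \<beta>D P.lact_closed P.lact_add_left P.lact_add_right P.lact_mult B_subset)
qed

text \<open>The second leg multiplies from outside, so any element of \<open>A\<close> passes
  through on the right; the first leg sits inside \<open>\<alpha>\<close>, so
  \<open>angle_lact\<close> lets only elements of \<open>B\<close> through on the left. For the
  square pairing the sides are exchanged.\<close>

lemma angle_ract:
  assumes \<alpha>: "\<alpha> \<in> Hom_BB A B P" and t: "t \<in> carrier Q" and a: "a \<in> carrier A"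
  shows "angle_pairing P \<alpha> (ract Q t a) = ract P (angle_pairing P \<alpha> t) a"
  using t
  by (rule add_hom_square_eqI[where G = P])
    ((rule add_hom_compose[OF Q.ract_add_hom[OF a] angle_pairing(1)[OF \<alpha>]]
      | rule add_hom_compose[OF angle_pairing(1)[OF \<alpha>] P.ract_add_hom[OF a]])+,
     simp add: angle_pairing[OF \<alpha>] ract_pure a Hom_BB_D[OF \<alpha>] P.ract_mult)

lemma angle_lact:
  assumes \<alpha>: "\<alpha> \<in> Hom_BB A B P" and t: "t \<in> carrier Q" and b: "b \<in> B"
  shows "angle_pairing P \<alpha> (lact Q b t) = lact P b (angle_pairing P \<alpha> t)"
  using t
  by (rule add_hom_square_eqI[where G = P])
    ((rule add_hom_compose[OF Q.lact_add_hom[OF B_subset[OF b]] angle_pairing(1)[OF \<alpha>]]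
      | rule add_hom_compose[OF angle_pairing(1)[OF \<alpha>] P.lact_add_hom[OF B_subset[OF b]]])+,
     simp add: angle_pairing[OF \<alpha>] lact_pure b B_subset Hom_BB_D[OF \<alpha>] P.lact_ract)

lemma square_lact:
  assumes \<beta>: "\<beta> \<in> Hom_BB A B P" and t: "t \<in> carrier Q" and a: "a \<in> carrier A"
  shows "square_pairing P (lact Q a t) \<beta> = lact P a (square_pairing P t \<beta>)"
  using t
  by (rule add_hom_square_eqI[where G = P])
    ((rule add_hom_compose[OF Q.lact_add_hom[OF a] square_pairing(1)[OF \<beta>]]
      | rule add_hom_compose[OF square_pairing(1)[OF \<beta>] P.lact_add_hom[OF a]])+,
     simp add: square_pairing[OF \<beta>] lact_pure a Hom_BB_D[OF \<beta>] P.lact_mult)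

lemma square_ract:
  assumes \<beta>: "\<beta> \<in> Hom_BB A B P" and t: "t \<in> carrier Q" and b: "b \<in> B"
  shows "square_pairing P (ract Q t b) \<beta> = ract P (square_pairing P t \<beta>) b"
  using t
  by (rule add_hom_square_eqI[where G = P])
    ((rule add_hom_compose[OF Q.ract_add_hom[OF B_subset[OF b]] square_pairing(1)[OF \<beta>]]
      | rule add_hom_compose[OF square_pairing(1)[OF \<beta>] P.ract_add_hom[OF B_subset[OF b]]])+,
     simp add: square_pairing[OF \<beta>] ract_pure b B_subset Hom_BB_D[OF \<beta>] P.lact_ract)

text \<open>Both pairings are \<open>B\<close>-\<open>B\<close>-bilinear in the tensor, so
  \<open>bt = tb\<close> is carried to their values.\<close>

lemma pairings_centralized:
  assumes \<alpha>: "\<alpha> \<in> Hom_BB A B P" and t: "t \<in> T_set A B"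
  shows "angle_pairing P \<alpha> t \<in> centralized B P" and "square_pairing P t \<alpha> \<in> centralized B P"
  using T_setD[OF t] B_subset angle_lact[OF \<alpha> T_setD(1)[OF t], symmetric]
    angle_ract[OF \<alpha> T_setD(1)[OF t], symmetric] square_lact[OF \<alpha> T_setD(1)[OF t], symmetric]
    square_ract[OF \<alpha> T_setD(1)[OF t], symmetric]
    add_hom_closed[OF angle_pairing(1)[OF \<alpha>], of t] add_hom_closed[OF square_pairing(1)[OF \<alpha>], of t]
  by (simp_all add: centralized_def)


end

end


section \<open>Duality for irreducible extensions\<close>

text \<open>A right and a left quasibasis together with irreducibility; their lengths
  \<open>N\<close> and \<open>N'\<close> are separate parameters.\<close>

locale irreducible_quasibases = ring_extension A B for A :: "('a, 'x) ring_scheme" (structure) and B +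
  fixes N N' :: nat and t u \<beta> \<gamma>
  assumes t: "i < N \<Longrightarrow> t i \<in> T_set A B" and \<beta>: "i < N \<Longrightarrow> \<beta> i \<in> Hom_BB A B RA"
    and right: "x \<in> carrier A \<Longrightarrow> pure x \<one> = (\<Oplus>\<^bsub>Q\<^esub>i \<in> {..<N}. ract Q (t i) (\<beta> i x))"
    and u: "j < N' \<Longrightarrow> u j \<in> T_set A B" and \<gamma>: "j < N' \<Longrightarrow> \<gamma> j \<in> Hom_BB A B RA"
    and left: "y \<in> carrier A \<Longrightarrow> pure \<one> y = (\<Oplus>\<^bsub>Q\<^esub>j \<in> {..<N'}. lact Q (\<gamma> j y) (u j))"
    and centralizer: "centralized B RA \<subseteq> B"
begin

interpretation Q: bimodule A A Q by (rule bimodule_square)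

text \<open>Pairings with values in \<open>RA\<close> get composed with scalar actions whose source
  is \<open>A\<close>; carrier and addition of the two agree.\<close>

lemma add_hom_RA: "add_hom RA M = add_hom A M" "add_hom M RA = add_hom M A"
  by (auto simp: hom_def)

lemmas angle_RA = angle_pairing(1)[OF bimodule_RA, unfolded add_hom_RA]
lemmas square_RA = square_pairing(1)[OF bimodule_RA, unfolded add_hom_RA]

lemma \<beta>_closed: "i < N \<Longrightarrow> x \<in> carrier A \<Longrightarrow> \<beta> i x \<in> carrier A"
  using Hom_BB_D(1)[OF \<beta>] by simp

lemma \<gamma>_closed: "j < N' \<Longrightarrow> x \<in> carrier A \<Longrightarrow> \<gamma> j x \<in> carrier A"
  using Hom_BB_D(1)[OF \<gamma>] by simp

text \<open>Multiply the quasibasis equation for \<open>x \<otimes> 1\<close> by \<open>y\<close> on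
  the right: the coefficient \<open>\<beta>\<^sub>i(x) y\<close> is the angle pairing of
  \<open>\<beta> i\<close> with \<open>x \<otimes> y\<close>.\<close>

lemma right_expansion:
  assumes s: "s \<in> carrier Q"
  shows "s = (\<Oplus>\<^bsub>Q\<^esub>i \<in> {..<N}. ract Q (t i) (angle_pairing RA (\<beta> i) s))"
proof (rule add_hom_square_eqI[OF s, where h = "\<lambda>s. s" and G = Q])
  show "(\<lambda>s. s) \<in> add_hom Q Q" by (rule add_homI) simp_all
  show "(\<lambda>s. \<Oplus>\<^bsub>Q\<^esub>i \<in> {..<N}. ract Q (t i) (angle_pairing RA (\<beta> i) s)) \<in> add_hom Q Q"
    by (intro add_hom_sum Q.M.abelian_group_axioms add_hom_compose[OF angle_RA Q.ract_scalar_add_hom])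
      (auto intro: \<beta> T_setD(1) t)
next
  fix x y assume x: "x \<in> carrier A" and y: "y \<in> carrier A"
  have "pure x y = ract Q (pure x \<one>) y"
    using x y by (simp add: ract_pure)
  also have "\<dots> = (\<Oplus>\<^bsub>Q\<^esub>i \<in> {..<N}. ract Q (ract Q (t i) (\<beta> i x)) y)"
    unfolding right[OF x]
    by (rule add_hom_finsum[OF Q.M.abelian_group_axioms Q.M.abelian_group_axioms Q.ract_add_hom[OF y]])
      (auto intro!: Q.ract_closed T_setD(1)[OF t] \<beta>_closed x)
  also have "\<dots> = (\<Oplus>\<^bsub>Q\<^esub>i \<in> {..<N}. ract Q (t i) (angle_pairing RA (\<beta> i) (pure x y)))"
    by (rule Q.M.finsum_cong')
      (auto simp: angle_pairing(2)[OF bimodule_RA \<beta>] x y Q.ract_mult[symmetric] T_setD(1)[OF t] \<beta>_closed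
        intro!: Q.ract_closed)
  finally show "pure x y = (\<Oplus>\<^bsub>Q\<^esub>i \<in> {..<N}. ract Q (t i) (angle_pairing RA (\<beta> i) (pure x y)))" .
qed

text \<open>Likewise from \<open>x (1 \<otimes> y)\<close>: the coefficient
  \<open>x \<gamma>\<^sub>j(y)\<close> is a square pairing with \<open>\<gamma> j\<close>.\<close>

lemma left_expansion:
  assumes s: "s \<in> carrier Q"
  shows "s = (\<Oplus>\<^bsub>Q\<^esub>j \<in> {..<N'}. lact Q (square_pairing RA s (\<gamma> j)) (u j))"
proof (rule add_hom_square_eqI[OF s, where h = "\<lambda>s. s" and G = Q])
  show "(\<lambda>s. s) \<in> add_hom Q Q" by (rule add_homI) simp_all
  show "(\<lambda>s. \<Oplus>\<^bsub>Q\<^esub>j \<in> {..<N'}. lact Q (square_pairing RA s (\<gamma> j)) (u j)) \<in> add_hom Q Q"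
    by (intro add_hom_sum Q.M.abelian_group_axioms add_hom_compose[OF square_RA Q.lact_scalar_add_hom])
      (auto intro: \<gamma> T_setD(1) u)
next
  fix x y assume x: "x \<in> carrier A" and y: "y \<in> carrier A"
  have "pure x y = lact Q x (pure \<one> y)"
    using x y by (simp add: lact_pure)
  also have "\<dots> = (\<Oplus>\<^bsub>Q\<^esub>j \<in> {..<N'}. lact Q x (lact Q (\<gamma> j y) (u j)))"
    unfolding left[OF y]
    by (rule add_hom_finsum[OF Q.M.abelian_group_axioms Q.M.abelian_group_axioms Q.lact_add_hom[OF x]])
      (auto intro!: Q.lact_closed T_setD(1)[OF u] \<gamma>_closed y)
  also have "\<dots> = (\<Oplus>\<^bsub>Q\<^esub>j \<in> {..<N'}. lact Q (square_pairing RA (pure x y) (\<gamma> j)) (u j))"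
    by (rule Q.M.finsum_cong')
      (auto simp: square_pairing(2)[OF bimodule_RA \<gamma>] x y Q.lact_mult[symmetric] T_setD(1)[OF u] \<gamma>_closed
        intro!: Q.lact_closed)
  finally show "pure x y = (\<Oplus>\<^bsub>Q\<^esub>j \<in> {..<N'}. lact Q (square_pairing RA (pure x y) (\<gamma> j)) (u j))" .
qed

text \<open>This is the only place where irreducibility enters: the coefficients of \<open>s \<in> T\<close> in either
  quasibase centralize \<open>B\<close>, so they lie in \<open>B\<close> and \<open>B\<close>-linear maps commute with them.\<close>

lemma pairings_RA_in_B:
  assumes "\<phi> \<in> Hom_BB A B RA" and "s \<in> T_set A B"
  shows "angle_pairing RA \<phi> s \<in> B" and "square_pairing RA s \<phi> \<in> B"
  using pairings_centralized[OF bimodule_RA assms] centralizer by blast+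

context
  fixes P :: "('a, 'a, 'p, 'z) bimodule_scheme"
  assumes P: "bimodule A A P"
begin

interpretation P: bimodule A A P by (rule P)

lemmas abelian = P.M.abelian_group_axioms Q.M.abelian_group_axioms

section \<open>Recovering a homomorphism from its pairings\<close>

lemma angle_expansion:
  assumes \<alpha>: "\<alpha> \<in> Hom_BB A B P" and x: "x \<in> carrier A"
  shows "\<alpha> x = (\<Oplus>\<^bsub>P\<^esub>i \<in> {..<N}. ract P (angle_pairing P \<alpha> (t i)) (\<beta> i x))"
proof -
  have "\<alpha> x = angle_pairing P \<alpha> (pure x \<one>)"
    using x by (simp add: angle_pairing(2)[OF P \<alpha>] P.ract_one Hom_BB_D(1)[OF \<alpha>])
  also have "\<dots> = (\<Oplus>\<^bsub>P\<^esub>i \<in> {..<N}. angle_pairing P \<alpha> (ract Q (t i) (\<beta> i x)))"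
    unfolding right[OF x]
    by (rule add_hom_finsum[OF abelian(2,1) angle_pairing(1)[OF P \<alpha>]])
      (auto intro!: Q.ract_closed T_setD(1)[OF t] \<beta>_closed x)
  also have "\<dots> = (\<Oplus>\<^bsub>P\<^esub>i \<in> {..<N}. ract P (angle_pairing P \<alpha> (t i)) (\<beta> i x))"
    by (rule P.M.finsum_cong')
      (auto simp: angle_ract[OF P \<alpha>] T_setD(1)[OF t] \<beta>_closed x
        intro!: P.ract_closed add_hom_closed[OF angle_pairing(1)[OF P \<alpha>]])
  finally show ?thesis .
qed

lemma square_expansion:
  assumes \<alpha>: "\<alpha> \<in> Hom_BB A B P" and y: "y \<in> carrier A"
  shows "\<alpha> y = (\<Oplus>\<^bsub>P\<^esub>j \<in> {..<N'}. lact P (\<gamma> j y) (square_pairing P (u j) \<alpha>))"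
proof -
  have "\<alpha> y = square_pairing P (pure \<one> y) \<alpha>"
    using y by (simp add: square_pairing(2)[OF P \<alpha>] P.lact_one Hom_BB_D(1)[OF \<alpha>])
  also have "\<dots> = (\<Oplus>\<^bsub>P\<^esub>j \<in> {..<N'}. square_pairing P (lact Q (\<gamma> j y) (u j)) \<alpha>)"
    unfolding left[OF y]
    by (rule add_hom_finsum[OF abelian(2,1) square_pairing(1)[OF P \<alpha>]])
      (auto intro!: Q.lact_closed T_setD(1)[OF u] \<gamma>_closed y)
  also have "\<dots> = (\<Oplus>\<^bsub>P\<^esub>j \<in> {..<N'}. lact P (\<gamma> j y) (square_pairing P (u j) \<alpha>))"
    by (rule P.M.finsum_cong')
      (auto simp: square_lact[OF P \<alpha>] T_setD(1)[OF u] \<gamma>_closed y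
        intro!: P.lact_closed add_hom_closed[OF square_pairing(1)[OF P \<alpha>]])
  finally show ?thesis .
qed

text \<open>By the expansion, \<open>\<alpha>\<close> is determined by its pairings with the
  finitely many \<open>t i\<close>. This yields injectivity of \<open>sigma\<close>;
  \<open>square_pairing_cancel\<close> below yields uniqueness of its values.\<close>

lemma angle_pairing_cancel:
  assumes "\<alpha> \<in> Hom_BB A B P" "\<alpha>' \<in> Hom_BB A B P"
    and "\<And>s. s \<in> T_set A B \<Longrightarrow> angle_pairing P \<alpha> s = angle_pairing P \<alpha>' s"
  shows "\<alpha> = \<alpha>'"
  by (rule Hom_BB_eqI[OF assms(1,2)])
    (auto simp: angle_expansion assms t \<beta>_closed T_setD(1)[OF t]
      intro!: P.M.finsum_cong' P.ract_closed add_hom_closed[OF angle_pairing(1)[OF P]])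

lemma square_pairing_cancel:
  assumes "\<alpha> \<in> Hom_BB A B P" "\<alpha>' \<in> Hom_BB A B P"
    and "\<And>s. s \<in> T_set A B \<Longrightarrow> square_pairing P s \<alpha> = square_pairing P s \<alpha>'"
  shows "\<alpha> = \<alpha>'"
  by (rule Hom_BB_eqI[OF assms(1,2)])
    (auto simp: square_expansion assms u \<gamma>_closed T_setD(1)[OF u]
      intro!: P.M.finsum_cong' P.lact_closed add_hom_closed[OF square_pairing(1)[OF P]])

text \<open>Left \<open>B\<close>-linearity is that of \<open>\<gamma> j\<close>. On the right,
  \<open>b\<close> leaves \<open>\<gamma> j\<close> and is moved past \<open>p j\<close>, which
  centralizes \<open>B\<close>: \<open>\<gamma>\<^sub>j(xb) p\<^sub>j = \<gamma>\<^sub>j(x) b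
  p\<^sub>j = \<gamma>\<^sub>j(x) p\<^sub>j b\<close>.\<close>

lemma left_combination_in_Hom_BB:
  assumes p: "\<And>j. j < N' \<Longrightarrow> p j \<in> centralized B P"
  shows "(\<lambda>a \<in> carrier A. \<Oplus>\<^bsub>P\<^esub>j \<in> {..<N'}. lact P (\<gamma> j a) (p j)) \<in> Hom_BB A B P"
    (is "?\<alpha> \<in> _")
proof -
  have pc: "p j \<in> carrier P" "b \<in> B \<Longrightarrow> lact P b (p j) = ract P (p j) b" if "j < N'" for j b
    using p[OF that] by (auto simp: centralized_def)
  have cl: "lact P (\<gamma> j a) (p j) \<in> carrier P" if "a \<in> carrier A" "j < N'" for a j
    using that by (intro P.lact_closed \<gamma>_closed pc)
  have scalar: "lact P (\<gamma> j (b \<otimes> x)) (p j) = lact P b (lact P (\<gamma> j x) (p j))"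
    "lact P (\<gamma> j (x \<otimes> b)) (p j) = ract P (lact P (\<gamma> j x) (p j)) b"
    if "j < N'" "b \<in> B" "x \<in> carrier A" for j b x
    using that Hom_BB_D(4,5)[OF \<gamma>, of j] pc
    by (simp_all add: P.lact_mult P.lact_ract \<gamma>_closed B_subset)
  show ?thesis
  proof (rule Hom_BB_I, goal_cases)
    case (3 x y)
    have "(\<Oplus>\<^bsub>P\<^esub>j \<in> {..<N'}. lact P (\<gamma> j (x \<oplus> y)) (p j)) =
        (\<Oplus>\<^bsub>P\<^esub>j \<in> {..<N'}. lact P (\<gamma> j x) (p j) \<oplus>\<^bsub>P\<^esub> lact P (\<gamma> j y) (p j))"
      using 3 Hom_BB_D(3)[OF \<gamma>]
      by (intro P.M.finsum_cong') (auto simp: cl P.lact_add_left \<gamma>_closed pc)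
    also have "\<dots> = ?\<alpha> x \<oplus>\<^bsub>P\<^esub> ?\<alpha> y"
      using 3 by (simp add: P.M.finsum_addf cl Pi_def)
    finally show ?case using 3 by simp
  next
    case (4 b x)
    have "(\<Oplus>\<^bsub>P\<^esub>j \<in> {..<N'}. lact P (\<gamma> j (b \<otimes> x)) (p j)) =
        (\<Oplus>\<^bsub>P\<^esub>j \<in> {..<N'}. lact P b (lact P (\<gamma> j x) (p j)))"
      using 4 by (intro P.M.finsum_cong') (auto simp: scalar cl P.lact_closed B_subset)
    also have "\<dots> = lact P b (\<Oplus>\<^bsub>P\<^esub>j \<in> {..<N'}. lact P (\<gamma> j x) (p j))"
      by (rule add_hom_finsum[OF abelian(1,1) P.lact_add_hom[OF B_subset[OF 4(1)]], symmetric])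
        (use 4 cl in auto)
    finally show ?case using 4 by (simp add: B_subset)
  next
    case (5 x b)
    have "(\<Oplus>\<^bsub>P\<^esub>j \<in> {..<N'}. lact P (\<gamma> j (x \<otimes> b)) (p j)) =
        (\<Oplus>\<^bsub>P\<^esub>j \<in> {..<N'}. ract P (lact P (\<gamma> j x) (p j)) b)"
      using 5 by (intro P.M.finsum_cong') (auto simp: scalar cl P.ract_closed B_subset)
    also have "\<dots> = ract P (\<Oplus>\<^bsub>P\<^esub>j \<in> {..<N'}. lact P (\<gamma> j x) (p j)) b"
      by (rule add_hom_finsum[OF abelian(1,1) P.ract_add_hom[OF B_subset[OF 5(2)]], symmetric])
        (use 5 cl in auto)
    finally show ?case using 5 by (simp add: B_subset)
  qed (auto intro!: P.M.finsum_closed cl)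
qed

text \<open>Here the centralizer condition serves the left action: \<open>p\<^sub>i
  \<beta>\<^sub>i(bx) = p\<^sub>i b \<beta>\<^sub>i(x) = b p\<^sub>i
  \<beta>\<^sub>i(x)\<close>.\<close>

lemma right_combination_in_Hom_BB:
  assumes p: "\<And>i. i < N \<Longrightarrow> p i \<in> centralized B P"
  shows "(\<lambda>a \<in> carrier A. \<Oplus>\<^bsub>P\<^esub>i \<in> {..<N}. ract P (p i) (\<beta> i a)) \<in> Hom_BB A B P"
    (is "?\<alpha> \<in> _")
proof -
  have pc: "p i \<in> carrier P" "b \<in> B \<Longrightarrow> lact P b (p i) = ract P (p i) b" if "i < N" for i b
    using p[OF that] by (auto simp: centralized_def)
  have cl: "ract P (p i) (\<beta> i a) \<in> carrier P" if "a \<in> carrier A" "i < N" for a i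
    using that by (intro P.ract_closed \<beta>_closed pc)
  have scalar: "ract P (p i) (\<beta> i (b \<otimes> x)) = lact P b (ract P (p i) (\<beta> i x))"
    "ract P (p i) (\<beta> i (x \<otimes> b)) = ract P (ract P (p i) (\<beta> i x)) b"
    if "i < N" "b \<in> B" "x \<in> carrier A" for i b x
    using that Hom_BB_D(4,5)[OF \<beta>, of i] pc
    by (simp_all add: P.ract_mult P.lact_ract[symmetric] \<beta>_closed B_subset)
  show ?thesis
  proof (rule Hom_BB_I, goal_cases)
    case (3 x y)
    have "(\<Oplus>\<^bsub>P\<^esub>i \<in> {..<N}. ract P (p i) (\<beta> i (x \<oplus> y))) =
        (\<Oplus>\<^bsub>P\<^esub>i \<in> {..<N}. ract P (p i) (\<beta> i x) \<oplus>\<^bsub>P\<^esub> ract P (p i) (\<beta> i y))"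
      using 3 Hom_BB_D(3)[OF \<beta>]
      by (intro P.M.finsum_cong') (auto simp: cl P.ract_add_right \<beta>_closed pc)
    also have "\<dots> = ?\<alpha> x \<oplus>\<^bsub>P\<^esub> ?\<alpha> y"
      using 3 by (simp add: P.M.finsum_addf cl Pi_def)
    finally show ?case using 3 by simp
  next
    case (4 b x)
    have "(\<Oplus>\<^bsub>P\<^esub>i \<in> {..<N}. ract P (p i) (\<beta> i (b \<otimes> x))) =
        (\<Oplus>\<^bsub>P\<^esub>i \<in> {..<N}. lact P b (ract P (p i) (\<beta> i x)))"
      using 4 by (intro P.M.finsum_cong') (auto simp: scalar cl P.lact_closed B_subset)
    also have "\<dots> = lact P b (\<Oplus>\<^bsub>P\<^esub>i \<in> {..<N}. ract P (p i) (\<beta> i x))"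
      by (rule add_hom_finsum[OF abelian(1,1) P.lact_add_hom[OF B_subset[OF 4(1)]], symmetric])
        (use 4 cl in auto)
    finally show ?case using 4 by (simp add: B_subset)
  next
    case (5 x b)
    have "(\<Oplus>\<^bsub>P\<^esub>i \<in> {..<N}. ract P (p i) (\<beta> i (x \<otimes> b))) =
        (\<Oplus>\<^bsub>P\<^esub>i \<in> {..<N}. ract P (ract P (p i) (\<beta> i x)) b)"
      using 5 by (intro P.M.finsum_cong') (auto simp: scalar cl P.ract_closed B_subset)
    also have "\<dots> = ract P (\<Oplus>\<^bsub>P\<^esub>i \<in> {..<N}. ract P (p i) (\<beta> i x)) b"
      by (rule add_hom_finsum[OF abelian(1,1) P.ract_add_hom[OF B_subset[OF 5(2)]], symmetric])
        (use 5 cl in auto)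
    finally show ?case using 5 by (simp add: B_subset)
  qed (auto intro!: P.M.finsum_closed cl)
qed

text \<open>Since \<open>s \<in> T\<close>, its left expansion has coefficients in \<open>B\<close>;
  this allows the angle pairing, which on the left is linear over \<open>B\<close>, to release
  them.\<close>

lemma angle_pairing_eq_sum:
  assumes \<alpha>: "\<alpha> \<in> Hom_BB A B P" and s: "s \<in> T_set A B"
  shows "angle_pairing P \<alpha> s =
    (\<Oplus>\<^bsub>P\<^esub>j \<in> {..<N'}. lact P (square_pairing RA s (\<gamma> j)) (angle_pairing P \<alpha> (u j)))"
proof -
  have inB: "square_pairing RA s (\<gamma> j) \<in> B" if "j < N'" for j
    by (rule pairings_RA_in_B(2)[OF \<gamma>[OF that] s])
  have "angle_pairing P \<alpha> s =
      angle_pairing P \<alpha> (\<Oplus>\<^bsub>Q\<^esub>j \<in> {..<N'}. lact Q (square_pairing RA s (\<gamma> j)) (u j))"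
    using left_expansion[OF T_setD(1)[OF s]] by simp
  also have "\<dots> = (\<Oplus>\<^bsub>P\<^esub>j \<in> {..<N'}. angle_pairing P \<alpha> (lact Q (square_pairing RA s (\<gamma> j)) (u j)))"
    by (rule add_hom_finsum[OF abelian(2,1) angle_pairing(1)[OF P \<alpha>]])
      (auto intro!: Q.lact_closed B_subset inB T_setD(1)[OF u])
  also have "\<dots> = (\<Oplus>\<^bsub>P\<^esub>j \<in> {..<N'}. lact P (square_pairing RA s (\<gamma> j)) (angle_pairing P \<alpha> (u j)))"
    by (rule P.M.finsum_cong')
      (auto simp: angle_lact[OF P \<alpha>] T_setD(1)[OF u] inB
        intro!: P.lact_closed B_subset add_hom_closed[OF angle_pairing(1)[OF P \<alpha>]])
  finally show ?thesis .
qed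

text \<open>The mirror image: the right expansion of \<open>s\<close> has coefficients in
  \<open>B\<close>, and the square pairing releases them on the right.\<close>

lemma square_pairing_eq_sum:
  assumes \<alpha>: "\<alpha> \<in> Hom_BB A B P" and s: "s \<in> T_set A B"
  shows "square_pairing P s \<alpha> =
    (\<Oplus>\<^bsub>P\<^esub>i \<in> {..<N}. ract P (square_pairing P (t i) \<alpha>) (angle_pairing RA (\<beta> i) s))"
proof -
  have inB: "angle_pairing RA (\<beta> i) s \<in> B" if "i < N" for i
    by (rule pairings_RA_in_B(1)[OF \<beta>[OF that] s])
  have "square_pairing P s \<alpha> =
      square_pairing P (\<Oplus>\<^bsub>Q\<^esub>i \<in> {..<N}. ract Q (t i) (angle_pairing RA (\<beta> i) s)) \<alpha>"
    using right_expansion[OF T_setD(1)[OF s]] by simp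
  also have "\<dots> = (\<Oplus>\<^bsub>P\<^esub>i \<in> {..<N}. square_pairing P (ract Q (t i) (angle_pairing RA (\<beta> i) s)) \<alpha>)"
    by (rule add_hom_finsum[OF abelian(2,1) square_pairing(1)[OF P \<alpha>]])
      (auto intro!: Q.ract_closed B_subset inB T_setD(1)[OF t])
  also have "\<dots> = (\<Oplus>\<^bsub>P\<^esub>i \<in> {..<N}. ract P (square_pairing P (t i) \<alpha>) (angle_pairing RA (\<beta> i) s))"
    by (rule P.M.finsum_cong')
      (auto simp: square_ract[OF P \<alpha>] T_setD(1)[OF t] inB
        intro!: P.ract_closed B_subset add_hom_closed[OF square_pairing(1)[OF P \<alpha>]])
  finally show ?thesis .
qed

text \<open>Provides the counterpart of \<open>angle_pairing_eq_sum\<close>: with \<open>p j\<close>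
  the angle pairing of \<open>\<alpha>\<close> and \<open>u j\<close>, both right-hand sides are the
  same sum.\<close>

lemma square_pairing_left_combination:
  assumes p: "\<And>j. j < N' \<Longrightarrow> p j \<in> centralized B P" and s: "s \<in> carrier Q"
  shows "square_pairing P s (\<lambda>a \<in> carrier A. \<Oplus>\<^bsub>P\<^esub>j \<in> {..<N'}. lact P (\<gamma> j a) (p j)) =
    (\<Oplus>\<^bsub>P\<^esub>j \<in> {..<N'}. lact P (square_pairing RA s (\<gamma> j)) (p j))"
proof (rule add_hom_square_eqI[OF s, where G = P])
  note hom = left_combination_in_Hom_BB[of p, OF p]
  have pc: "p j \<in> carrier P" if "j < N'" for j
    using p[OF that] by (simp add: centralized_def)
  show "(\<lambda>s. square_pairing P s (\<lambda>a \<in> carrier A. \<Oplus>\<^bsub>P\<^esub>j \<in> {..<N'}. lact P (\<gamma> j a) (p j))) \<in> add_hom Q P"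
    by (rule square_pairing(1)[OF P hom])
  show "(\<lambda>s. \<Oplus>\<^bsub>P\<^esub>j \<in> {..<N'}. lact P (square_pairing RA s (\<gamma> j)) (p j)) \<in> add_hom Q P"
    by (intro add_hom_sum abelian(1) add_hom_compose[OF square_RA P.lact_scalar_add_hom])
      (auto intro: \<gamma> pc)
  fix x y assume x: "x \<in> carrier A" and y: "y \<in> carrier A"
  have "square_pairing P (pure x y) (\<lambda>a \<in> carrier A. \<Oplus>\<^bsub>P\<^esub>j \<in> {..<N'}. lact P (\<gamma> j a) (p j)) =
      lact P x (\<Oplus>\<^bsub>P\<^esub>j \<in> {..<N'}. lact P (\<gamma> j y) (p j))"
    using x y by (simp add: square_pairing(2)[OF P hom])
  also have "\<dots> = (\<Oplus>\<^bsub>P\<^esub>j \<in> {..<N'}. lact P x (lact P (\<gamma> j y) (p j)))"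
    by (rule add_hom_finsum[OF abelian(1,1) P.lact_add_hom[OF x]])
      (auto intro!: P.lact_closed \<gamma>_closed pc y)
  also have "\<dots> = (\<Oplus>\<^bsub>P\<^esub>j \<in> {..<N'}. lact P (square_pairing RA (pure x y) (\<gamma> j)) (p j))"
    by (rule P.M.finsum_cong')
      (auto simp: square_pairing(2)[OF bimodule_RA \<gamma>] x y P.lact_mult[symmetric] \<gamma>_closed pc
        intro!: P.lact_closed)
  finally show "square_pairing P (pure x y) (\<lambda>a \<in> carrier A. \<Oplus>\<^bsub>P\<^esub>j \<in> {..<N'}. lact P (\<gamma> j a) (p j)) =
      (\<Oplus>\<^bsub>P\<^esub>j \<in> {..<N'}. lact P (square_pairing RA (pure x y) (\<gamma> j)) (p j))" .
qed

text \<open>Matches \<open>square_pairing_eq_sum\<close> when \<open>p i\<close> is the square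
  pairing of \<open>t i\<close> and \<open>\<alpha>\<close>.\<close>

lemma angle_pairing_right_combination:
  assumes p: "\<And>i. i < N \<Longrightarrow> p i \<in> centralized B P" and s: "s \<in> carrier Q"
  shows "angle_pairing P (\<lambda>a \<in> carrier A. \<Oplus>\<^bsub>P\<^esub>i \<in> {..<N}. ract P (p i) (\<beta> i a)) s =
    (\<Oplus>\<^bsub>P\<^esub>i \<in> {..<N}. ract P (p i) (angle_pairing RA (\<beta> i) s))"
proof (rule add_hom_square_eqI[OF s, where G = P])
  note hom = right_combination_in_Hom_BB[of p, OF p]
  have pc: "p i \<in> carrier P" if "i < N" for i
    using p[OF that] by (simp add: centralized_def)
  show "angle_pairing P (\<lambda>a \<in> carrier A. \<Oplus>\<^bsub>P\<^esub>i \<in> {..<N}. ract P (p i) (\<beta> i a)) \<in> add_hom Q P"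
    by (rule angle_pairing(1)[OF P hom])
  show "(\<lambda>s. \<Oplus>\<^bsub>P\<^esub>i \<in> {..<N}. ract P (p i) (angle_pairing RA (\<beta> i) s)) \<in> add_hom Q P"
    by (intro add_hom_sum abelian(1) add_hom_compose[OF angle_RA P.ract_scalar_add_hom])
      (auto intro: \<beta> pc)
  fix x y assume x: "x \<in> carrier A" and y: "y \<in> carrier A"
  have "angle_pairing P (\<lambda>a \<in> carrier A. \<Oplus>\<^bsub>P\<^esub>i \<in> {..<N}. ract P (p i) (\<beta> i a)) (pure x y) =
      ract P (\<Oplus>\<^bsub>P\<^esub>i \<in> {..<N}. ract P (p i) (\<beta> i x)) y"
    using x y by (simp add: angle_pairing(2)[OF P hom])
  also have "\<dots> = (\<Oplus>\<^bsub>P\<^esub>i \<in> {..<N}. ract P (ract P (p i) (\<beta> i x)) y)"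
    by (rule add_hom_finsum[OF abelian(1,1) P.ract_add_hom[OF y]])
      (auto intro!: P.ract_closed \<beta>_closed pc x)
  also have "\<dots> = (\<Oplus>\<^bsub>P\<^esub>i \<in> {..<N}. ract P (p i) (angle_pairing RA (\<beta> i) (pure x y)))"
    by (rule P.M.finsum_cong')
      (auto simp: angle_pairing(2)[OF bimodule_RA \<beta>] x y P.ract_mult[symmetric] \<beta>_closed pc
        intro!: P.ract_closed)
  finally show "angle_pairing P (\<lambda>a \<in> carrier A. \<Oplus>\<^bsub>P\<^esub>i \<in> {..<N}. ract P (p i) (\<beta> i a)) (pure x y) =
      (\<Oplus>\<^bsub>P\<^esub>i \<in> {..<N}. ract P (p i) (angle_pairing RA (\<beta> i) (pure x y)))" .
qed

lemma ex_square_pairing_eq: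
  assumes \<alpha>: "\<alpha> \<in> Hom_BB A B P"
  shows "\<exists>\<alpha>' \<in> Hom_BB A B P. \<forall>s \<in> T_set A B. angle_pairing P \<alpha> s = square_pairing P s \<alpha>'"
proof -
  \<comment> \<open>The pairings of \<open>\<alpha>\<close> with the \<open>u j\<close> become the
    coefficients of the image of \<open>\<alpha>\<close>; they centralize \<open>B\<close>, as the
    combination lemmas demand.\<close>
  note p = pairings_centralized(1)[OF P \<alpha> u]
  show ?thesis
    using left_combination_in_Hom_BB[of "\<lambda>j. angle_pairing P \<alpha> (u j)", OF p]
      square_pairing_left_combination[of "\<lambda>j. angle_pairing P \<alpha> (u j)", OF p T_setD(1)]
    by (auto simp: angle_pairing_eq_sum[OF \<alpha>] intro!: bexI)
qed

text \<open>For surjectivity of \<open>sigma\<close>: the witness is a preimage of the given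
  \<open>\<alpha>\<close>.\<close>

lemma ex_angle_pairing_eq:
  assumes \<alpha>: "\<alpha> \<in> Hom_BB A B P"
  shows "\<exists>\<alpha>' \<in> Hom_BB A B P. \<forall>s \<in> T_set A B. angle_pairing P \<alpha>' s = square_pairing P s \<alpha>"
proof -
  note p = pairings_centralized(2)[OF P \<alpha> t]
  show ?thesis
    using right_combination_in_Hom_BB[of "\<lambda>i. square_pairing P (t i) \<alpha>", OF p]
      angle_pairing_right_combination[of "\<lambda>i. square_pairing P (t i) \<alpha>", OF p T_setD(1)]
    by (auto simp: square_pairing_eq_sum[OF \<alpha>] intro!: bexI)
qed

section \<open>The map \<open>sigma\<close> and its values\<close>

lemma ex1_square_pairing_eq:
  assumes "\<alpha> \<in> Hom_BB A B P"
  shows "\<exists>!\<alpha>'. \<alpha>' \<in> Hom_BB A B P \<and> (\<forall>s \<in> T_set A B. angle_pairing P \<alpha> s = square_pairing P s \<alpha>')"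
  using ex_square_pairing_eq[OF assms] square_pairing_cancel by (metis (no_types, lifting))

lemma sigma_pairing:
  assumes "\<alpha> \<in> Hom_BB A B P"
  shows "sigma A B P \<alpha> \<in> Hom_BB A B P"
    and "s \<in> T_set A B \<Longrightarrow> square_pairing P s (sigma A B P \<alpha>) = angle_pairing P \<alpha> s"
  using theI'[OF ex1_square_pairing_eq[OF assms]] by (auto simp: sigma_def)

lemma sigma_eqI:
  assumes "\<alpha> \<in> Hom_BB A B P" "\<alpha>' \<in> Hom_BB A B P"
    and "\<And>s. s \<in> T_set A B \<Longrightarrow> angle_pairing P \<alpha> s = square_pairing P s \<alpha>'"
  shows "sigma A B P \<alpha> = \<alpha>'"
  using sigma_pairing[OF assms(1)] assms(2,3) by (intro square_pairing_cancel) auto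

text \<open>The image of \<open>\<alpha>\<close> determines all angle pairings of
  \<open>\<alpha>\<close>, so injectivity is \<open>angle_pairing_cancel\<close>; surjectivity is
  \<open>ex_angle_pairing_eq\<close>.\<close>

lemma bij_betw_sigma: "bij_betw (sigma A B P) (Hom_BB A B P) (Hom_BB A B P)"
proof (rule bij_betw_imageI)
  show "inj_on (sigma A B P) (Hom_BB A B P)"
    by (rule inj_onI) (metis angle_pairing_cancel sigma_pairing(2))
  show "sigma A B P ` Hom_BB A B P = Hom_BB A B P"
  proof (intro equalityI subsetI)
    fix \<alpha> assume "\<alpha> \<in> Hom_BB A B P"
    then obtain \<alpha>' where "\<alpha>' \<in> Hom_BB A B P" "sigma A B P \<alpha>' = \<alpha>"
      using ex_angle_pairing_eq sigma_eqI by metis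
    then show "\<alpha> \<in> sigma A B P ` Hom_BB A B P" by blast
  qed (use sigma_pairing(1) in blast)
qed

lemma lmul_rmul_Hom_BB:
  assumes "p \<in> centralized B P"
  shows "lmul A P p \<in> Hom_BB A B P" "rmul A P p \<in> Hom_BB A B P"
  using lmul_rmul_in_Hom_BB[OF P _ assms] B_subset by blast+

text \<open>The claim amounts to \<open>p s^1 s^2 = s^1 s^2 p\<close>. It holds because
  \<open>s^1 s^2\<close> centralizes \<open>B\<close>, hence lies in \<open>B\<close>, and
  \<open>p\<close> commutes with \<open>B\<close>.\<close>

lemma sigma_lmul:
  assumes p: "p \<in> centralized B P"
  shows "sigma A B P (lmul A P p) = rmul A P p"
proof (rule sigma_eqI[OF lmul_rmul_Hom_BB[OF p]])
  fix s assume s: "s \<in> T_set A B"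
  have pc: "p \<in> carrier P" using p by (simp add: centralized_def)
  \<comment> \<open>The identity of \<open>A\<close>, cut off outside the carrier so as to be a
    homomorphism; the angle pairing with it is the multiplication \<open>s^1 s^2\<close>.\<close>
  let ?\<iota> = "\<lambda>x \<in> carrier A. x"
  have \<iota>: "?\<iota> \<in> Hom_BB A B RA"
    by (rule Hom_BB_I) (auto simp: B_subset)
  have "angle_pairing P (lmul A P p) s = ract P p (angle_pairing RA ?\<iota> s)"
  proof (rule add_hom_square_eqI[OF T_setD(1)[OF s] angle_pairing(1)[OF P lmul_rmul_Hom_BB(1)[OF p]]
        add_hom_compose[OF angle_RA[OF \<iota>] P.ract_scalar_add_hom[OF pc]]])
    fix x y assume xy: "x \<in> carrier A" "y \<in> carrier A"
    then show "angle_pairing P (lmul A P p) (pure x y) = ract P p (angle_pairing RA ?\<iota> (pure x y))"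
      unfolding angle_pairing(2)[OF P lmul_rmul_Hom_BB(1)[OF p] xy] angle_pairing(2)[OF bimodule_RA \<iota> xy]
      by (simp add: lmul_def P.ract_mult pc)
  qed
  also have "\<dots> = lact P (angle_pairing RA ?\<iota> s) p"
    using p pairings_RA_in_B(1)[OF \<iota> s] by (simp add: centralized_def)
  also have "\<dots> = square_pairing P s (rmul A P p)"
  proof (rule add_hom_square_eqI[OF T_setD(1)[OF s]
        add_hom_compose[OF angle_RA[OF \<iota>] P.lact_scalar_add_hom[OF pc]]
        square_pairing(1)[OF P lmul_rmul_Hom_BB(2)[OF p]]])
    fix x y assume xy: "x \<in> carrier A" "y \<in> carrier A"
    then show "lact P (angle_pairing RA ?\<iota> (pure x y)) p = square_pairing P (pure x y) (rmul A P p)"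
      unfolding square_pairing(2)[OF P lmul_rmul_Hom_BB(2)[OF p] xy] angle_pairing(2)[OF bimodule_RA \<iota> xy]
      by (simp add: rmul_def P.lact_mult pc)
  qed
  finally show "angle_pairing P (lmul A P p) s = square_pairing P s (rmul A P p)" .
qed

text \<open>Both pairings equal \<open>s^1 p s^2\<close>. As \<open>sigma\<close> is injective, this
  gives the value of its inverse at \<open>lmul A P p\<close>.\<close>

lemma sigma_rmul:
  assumes p: "p \<in> centralized B P"
  shows "sigma A B P (rmul A P p) = lmul A P p"
proof (rule sigma_eqI[OF lmul_rmul_Hom_BB(2,1)[OF p]])
  fix s assume s: "s \<in> T_set A B"
  have pc: "p \<in> carrier P" using p by (simp add: centralized_def)
  show "angle_pairing P (rmul A P p) s = square_pairing P s (lmul A P p)"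
  proof (rule add_hom_square_eqI[OF T_setD(1)[OF s] angle_pairing(1)[OF P] square_pairing(1)[OF P]])
    fix x y assume xy: "x \<in> carrier A" "y \<in> carrier A"
    then show "angle_pairing P (rmul A P p) (pure x y) = square_pairing P (pure x y) (lmul A P p)"
      unfolding angle_pairing(2)[OF P lmul_rmul_Hom_BB(2)[OF p] xy]
        square_pairing(2)[OF P lmul_rmul_Hom_BB(1)[OF p] xy]
      by (simp add: lmul_def rmul_def P.lact_ract pc)
  qed (rule lmul_rmul_Hom_BB[OF p])+
qed

text \<open>Evaluate the defining equation of \<open>sigma\<close> at \<open>1 \<otimes> 1\<close>,
  which lies in \<open>T\<close> because \<open>b \<otimes> 1 = 1 \<otimes> b\<close>.\<close>

lemma sigma_one:
  assumes \<alpha>: "\<alpha> \<in> Hom_BB A B P"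
  shows "sigma A B P \<alpha> \<one> = \<alpha> \<one>"
proof -
  have "pure \<one> \<one> \<in> T_set A B"
    using pure_balanced[of \<one> _ \<one>]
    by (auto simp: T_set_def centralized_def pure_closed lact_pure ract_pure B_subset)
  from sigma_pairing(2)[OF \<alpha> this] show ?thesis
    using Hom_BB_D(1)[OF \<alpha>, of \<one>] Hom_BB_D(1)[OF sigma_pairing(1)[OF \<alpha>], of \<one>]
    by (simp add: angle_pairing(2)[OF P \<alpha>] square_pairing(2)[OF P sigma_pairing(1)[OF \<alpha>]]
        P.lact_one P.ract_one)
qed

lemma zero_in_Hom_BB: "(\<lambda>a \<in> carrier A. \<zero>\<^bsub>P\<^esub>) \<in> Hom_BB A B P"
  using add_hom_zero[OF abelian(1,1) P.lact_add_hom] add_hom_zero[OF abelian(1,1) P.ract_add_hom]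
  by (intro Hom_BB_I) (auto simp: B_subset)

text \<open>The coefficients in \<open>angle_expansion\<close> and \<open>square_expansion\<close>
  are pairings with the \<open>t i\<close> and the \<open>u j\<close>, so every term
  vanishes.\<close>

lemma pairings_nondegenerate:
  assumes "\<alpha> \<in> Hom_BB A B P"
  shows "(\<And>s. s \<in> T_set A B \<Longrightarrow> angle_pairing P \<alpha> s = \<zero>\<^bsub>P\<^esub>) \<Longrightarrow> \<alpha> = (\<lambda>a \<in> carrier A. \<zero>\<^bsub>P\<^esub>)"
    and "(\<And>s. s \<in> T_set A B \<Longrightarrow> square_pairing P s \<alpha> = \<zero>\<^bsub>P\<^esub>) \<Longrightarrow> \<alpha> = (\<lambda>a \<in> carrier A. \<zero>\<^bsub>P\<^esub>)"
proof -
  have zero: "lact P a \<zero>\<^bsub>P\<^esub> = \<zero>\<^bsub>P\<^esub>" "ract P \<zero>\<^bsub>P\<^esub> a = \<zero>\<^bsub>P\<^esub>" if "a \<in> carrier A" for a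
    using add_hom_zero[OF abelian(1,1)] P.lact_add_hom[OF that] P.ract_add_hom[OF that] by blast+
  show "\<alpha> = (\<lambda>a \<in> carrier A. \<zero>\<^bsub>P\<^esub>)"
    if "\<And>s. s \<in> T_set A B \<Longrightarrow> angle_pairing P \<alpha> s = \<zero>\<^bsub>P\<^esub>"
    by (rule Hom_BB_eqI[OF assms zero_in_Hom_BB])
      (simp add: angle_expansion[OF assms] that t zero \<beta>_closed cong: P.M.finsum_cong)
  show "\<alpha> = (\<lambda>a \<in> carrier A. \<zero>\<^bsub>P\<^esub>)"
    if "\<And>s. s \<in> T_set A B \<Longrightarrow> square_pairing P s \<alpha> = \<zero>\<^bsub>P\<^esub>"
    by (rule Hom_BB_eqI[OF assms zero_in_Hom_BB])
      (simp add: square_expansion[OF assms] that u zero \<gamma>_closed cong: P.M.finsum_cong)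
qed

end

end

theorem proposition5p2:
  fixes K :: "('k, 'x) ring_scheme" and A :: "('k, 'a, 'y) module_scheme" and B :: "'a set"
    and P :: "('a, 'a, 'p, 'z) bimodule_scheme"
  assumes "assoc_algebra K A" and "unital_subalgebra B K A"
    and "irreducible_extension A B"
    and "bimodule A A P"
  shows
    "(\<forall>\<alpha> \<in> Hom_BB A B P. \<forall>t \<in> T_set A B. angle_pairing P \<alpha> t \<in> centralized B P) \<and>
     (\<forall>\<beta> \<in> Hom_BB A B P. \<forall>u \<in> T_set A B. square_pairing P u \<beta> \<in> centralized B P) \<and>
     (\<forall>\<alpha> \<in> Hom_BB A B P.
        (\<forall>t \<in> T_set A B. angle_pairing P \<alpha> t = \<zero>\<^bsub>P\<^esub>) \<longrightarrow> \<alpha> = (\<lambda>a\<in>carrier A. \<zero>\<^bsub>P\<^esub>)) \<and>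
     (\<forall>\<beta> \<in> Hom_BB A B P.
        (\<forall>u \<in> T_set A B. square_pairing P u \<beta> = \<zero>\<^bsub>P\<^esub>) \<longrightarrow> \<beta> = (\<lambda>a\<in>carrier A. \<zero>\<^bsub>P\<^esub>)) \<and>
     (\<forall>\<alpha> \<in> Hom_BB A B P. \<exists>!\<alpha>'. \<alpha>' \<in> Hom_BB A B P \<and>
        (\<forall>t \<in> T_set A B. angle_pairing P \<alpha> t = square_pairing P t \<alpha>')) \<and>
     bij_betw (sigma A B P) (Hom_BB A B P) (Hom_BB A B P) \<and>
     (\<forall>p \<in> centralized B P.
        sigma A B P (lmul A P p) = rmul A P p \<and>
        inv_into (Hom_BB A B P) (sigma A B P) (lmul A P p) = rmul A P p) \<and>
     (\<forall>\<alpha> \<in> Hom_BB A B P. sigma A B P \<alpha> \<one>\<^bsub>A\<^esub> = \<alpha> \<one>\<^bsub>A\<^esub>)"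
proof -
  interpret A: ring A
    using assms(1) by (rule assoc_algebra.axioms)
  interpret ring_extension A B
    by (intro ring_extension.intro ring_extension_axioms.intro A.ring_axioms)
      (use assms(2) in \<open>simp add: unital_subalgebra_def\<close>)
  obtain N where N: "iso_to_direct_summand AB A Q (power_bimodule RA N)"
      "iso_to_direct_summand A AB Q (power_bimodule RA N)"
    and centralizer: "centralized B RA \<subseteq> B"
    using assms(3) unfolding irreducible_extension_def depth_two_def by blast
  obtain t \<beta> where right: "\<And>i. i < N \<Longrightarrow> t i \<in> T_set A B" "\<And>i. i < N \<Longrightarrow> \<beta> i \<in> Hom_BB A B RA"
    "\<And>x. x \<in> carrier A \<Longrightarrow> pure x \<one>\<^bsub>A\<^esub> = (\<Oplus>\<^bsub>Q\<^esub>i \<in> {..<N}. ract Q (t i) (\<beta> i x))"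
    using right_quasibase[OF N(1)] by blast
  obtain u \<gamma> where left: "\<And>i. i < N \<Longrightarrow> u i \<in> T_set A B" "\<And>i. i < N \<Longrightarrow> \<gamma> i \<in> Hom_BB A B RA"
    "\<And>y. y \<in> carrier A \<Longrightarrow> pure \<one>\<^bsub>A\<^esub> y = (\<Oplus>\<^bsub>Q\<^esub>i \<in> {..<N}. lact Q (\<gamma> i y) (u i))"
    using left_quasibase[OF N(2)] by blast
  \<comment> \<open>Depth two supplies one exponent for both splittings, so the two quasibases have
    the same length.\<close>
  interpret irreducible_quasibases A B N N t u \<beta> \<gamma>
    by unfold_locales (fact right left centralizer)+
  note P = assms(4)
  have "inv_into (Hom_BB A B P) (sigma A B P) (lmul A P p) = rmul A P p"
    if "p \<in> centralized B P" for p
    using bij_betw_sigma[OF P] lmul_rmul_Hom_BB(2)[OF P that] sigma_rmul[OF P that]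
    by (metis bij_betw_inv_into_left)
  then show ?thesis
    using pairings_centralized[OF P] pairings_nondegenerate[OF P] ex1_square_pairing_eq[OF P]
      bij_betw_sigma[OF P] sigma_lmul[OF P] sigma_one[OF P]
    by simp
qed

end
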